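(* The 3SAT problem is reducible in polynomial time to the following problem (unital bilinear feasibility). Input: positive integers $n,m$ and matrices $V_1,\dots,V_m\in\mathbb{C}^{n\times n}$ with rational entries satisfying $\sum_{i=1}^m V_i^*V_i=I_n$. Question: do there exist nonzero vectors $x,y\in\mathbb{C}^n$ such that $x^TV_iy=0$ for all $i=1,\dots,m$?
   Context: $V^*$ denotes the conjugate transpose and $x^T$ the transpose. Rational entries means entries in $\mathbb{Q}+i\mathbb{Q}$. Complexity is measured in the bit model. *)

theory Defs
  imports "Jordan_Normal_Form.Schur_Decomposition"
begin

section \<open>Polynomial-time reductions between decision problems\<close>

text \<open>
  Deterministic multi-tape Turing machines with two-way infinite tapes. States and tape symbols are
  initial segments of the natural numbers; state 0 is initial and state 1 is the halting state;
  symbol 0 is the blank and symbols 1 and 2 stand for the bits 0 and 1. The transition function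
  takes the state and the list of scanned symbols, one per tape, and yields the next state and, for
  each tape, the symbol to write and the head movement. Only its values on the finite domain
  described in \<open>wf_tm\<close> matter for runs.
\<close>

datatype head_move = Move_Left | Move_Right | Stay

record tm =
  tm_tapes :: nat
  tm_symbols :: nat
  tm_states :: nat
  tm_trans :: "nat \<Rightarrow> nat list \<Rightarrow> nat \<times> (nat \<times> head_move) list"

definition wf_tm :: "tm \<Rightarrow> bool" where
  "wf_tm M \<longleftrightarrow> 1 \<le> tm_tapes M \<and> 3 \<le> tm_symbols M \<and> 2 \<le> tm_states M \<and>
     (\<forall>q < tm_states M. \<forall>rs. length rs = tm_tapes M \<and> set rs \<subseteq> {..< tm_symbols M} \<longrightarrow>
        (case tm_trans M q rs of (q', as) \<Rightarrow>
           q' < tm_states M \<and> length as = tm_tapes M \<and> (\<forall>(s, d) \<in> set as. s < tm_symbols M)))"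

text \<open>A tape is given by its contents and the position of its head.\<close>

type_synonym tape = "(int \<Rightarrow> nat) \<times> int"

type_synonym tm_config = "nat \<times> tape list"

fun scanned :: "tape \<Rightarrow> nat" where
  "scanned (c, h) = c h"

fun head_offset :: "head_move \<Rightarrow> int" where
  "head_offset Move_Left = - 1"
| "head_offset Move_Right = 1"
| "head_offset Stay = 0"

fun act_on_tape :: "nat \<times> head_move \<Rightarrow> tape \<Rightarrow> tape" where
  "act_on_tape (s, d) (c, h) = (c(h := s), h + head_offset d)"

fun tm_step :: "tm \<Rightarrow> tm_config \<Rightarrow> tm_config" where
  "tm_step M (q, ts) =
     (if q = 1 then (q, ts)
      else case tm_trans M q (map scanned ts) of (q', as) \<Rightarrow> (q', map2 act_on_tape as ts))"

definition word_contents :: "bool list \<Rightarrow> int \<Rightarrow> nat" where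
  "word_contents w i =
     (if 0 \<le> i \<and> i < int (length w) then (if w ! nat i then 2 else 1) else 0)"

definition tm_init :: "tm \<Rightarrow> bool list \<Rightarrow> tm_config" where
  "tm_init M w = (0, (word_contents w, 0) # replicate (tm_tapes M - 1) (word_contents [], 0))"

text \<open>
  The input is on the first tape and the output on the last one; these coincide for a machine with
  a single tape.
\<close>

definition tm_computes_within :: "tm \<Rightarrow> bool list \<Rightarrow> bool list \<Rightarrow> nat \<Rightarrow> bool" where
  "tm_computes_within M w v t \<longleftrightarrow>
     (\<exists>t' \<le> t. \<exists>ts. (tm_step M ^^ t') (tm_init M w) = (1, ts) \<and> fst (last ts) = word_contents v)"

text \<open>
  A decision problem consists of its instances, the question asked about an instance, and the
  encoding of instances as bit strings.
\<close>

record 'a decision_problem =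
  instances :: "'a set"
  question :: "'a \<Rightarrow> bool"
  encoding :: "'a \<Rightarrow> bool list"

definition poly_time_computable_on ::
  "'a set \<Rightarrow> ('a \<Rightarrow> bool list) \<Rightarrow> ('b \<Rightarrow> bool list) \<Rightarrow> ('a \<Rightarrow> 'b) \<Rightarrow> bool" where
  "poly_time_computable_on D enc enc' f \<longleftrightarrow>
     (\<exists>M (p :: nat poly). wf_tm M \<and>
        (\<forall>a \<in> D. tm_computes_within M (enc a) (enc' (f a)) (poly p (length (enc a)))))"

definition poly_time_reducible :: "'a decision_problem \<Rightarrow> 'b decision_problem \<Rightarrow> bool" where
  "poly_time_reducible A B \<longleftrightarrow>
     (\<exists>f. f \<in> instances A \<rightarrow> instances B \<and>
          (\<forall>a \<in> instances A. question A a \<longleftrightarrow> question B (f a)) \<and>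
          poly_time_computable_on (instances A) (encoding A) (encoding B) f)"


section \<open>Encodings\<close>

text \<open>
  Every code below is self-delimiting, so that codes can be concatenated. In a list each element is
  preceded by \<open>True\<close>, and \<open>False\<close> marks the end. Numbers are written in binary, least significant
  digit first; rationals are written as fractions in lowest terms.
\<close>

definition enc_list :: "('a \<Rightarrow> bool list) \<Rightarrow> 'a list \<Rightarrow> bool list" where
  "enc_list enc xs = concat (map (\<lambda>x. True # enc x) xs) @ [False]"

fun binary_digits :: "nat \<Rightarrow> bool list" where
  "binary_digits n = (if n = 0 then [] else odd n # binary_digits (n div 2))"

declare binary_digits.simps [simp del]

definition enc_nat :: "nat \<Rightarrow> bool list" where
  "enc_nat n = enc_list (\<lambda>b. [b]) (binary_digits n)"

definition enc_int :: "int \<Rightarrow> bool list" where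
  "enc_int k = (k < 0) # enc_nat (nat \<bar>k\<bar>)"

definition enc_rat :: "rat \<Rightarrow> bool list" where
  "enc_rat r = (case quotient_of r of (a, b) \<Rightarrow> enc_int a @ enc_nat (nat b))"

definition gaussian_rationals :: "complex set" where
  "gaussian_rationals = {z. Re z \<in> \<rat> \<and> Im z \<in> \<rat>}"

text \<open>Meaningful only for elements of \<^const>\<open>gaussian_rationals\<close>.\<close>

definition enc_complex :: "complex \<Rightarrow> bool list" where
  "enc_complex z =
     enc_rat (the_inv real_of_rat (Re z)) @ enc_rat (the_inv real_of_rat (Im z))"

definition enc_mat :: "complex mat \<Rightarrow> bool list" where
  "enc_mat A = enc_list (enc_list enc_complex) (mat_to_list A)"


section \<open>The 3SAT problem\<close>

text \<open>
  A literal is a variable with a sign, \<open>True\<close> for the variable itself and \<open>False\<close> for its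
  negation. A clause has exactly three literals, which need not be distinct.
\<close>

type_synonym literal = "bool \<times> nat"
type_synonym clause3 = "literal \<times> literal \<times> literal"

fun literal_true :: "(nat \<Rightarrow> bool) \<Rightarrow> literal \<Rightarrow> bool" where
  "literal_true \<sigma> (s, v) \<longleftrightarrow> \<sigma> v = s"

fun clause_true :: "(nat \<Rightarrow> bool) \<Rightarrow> clause3 \<Rightarrow> bool" where
  "clause_true \<sigma> (a, b, c) \<longleftrightarrow> literal_true \<sigma> a \<or> literal_true \<sigma> b \<or> literal_true \<sigma> c"

definition satisfiable :: "clause3 list \<Rightarrow> bool" where
  "satisfiable F \<longleftrightarrow> (\<exists>\<sigma>. \<forall>C \<in> set F. clause_true \<sigma> C)"

fun enc_literal :: "literal \<Rightarrow> bool list" where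
  "enc_literal (s, v) = s # enc_nat v"

fun enc_clause :: "clause3 \<Rightarrow> bool list" where
  "enc_clause (a, b, c) = enc_literal a @ enc_literal b @ enc_literal c"

definition three_sat :: "clause3 list decision_problem" where
  "three_sat = \<lparr>instances = UNIV, question = satisfiable, encoding = enc_list enc_clause\<rparr>"


section \<open>Unital bilinear feasibility\<close>

type_synonym bilinear_system = "nat \<times> nat \<times> complex mat list"

text \<open>The matrix \<open>\<Sum>V\<in>Vs. V\<^sup>* V\<close>, for square matrices of order \<open>n\<close>.\<close>

definition gram_sum :: "nat \<Rightarrow> complex mat list \<Rightarrow> complex mat" where
  "gram_sum n Vs = foldr (+) (map (\<lambda>V. mat_adjoint V * V) Vs) (0\<^sub>m n n)"

fun unital_system :: "bilinear_system \<Rightarrow> bool" where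
  "unital_system (n, m, Vs) \<longleftrightarrow>
     0 < n \<and> 0 < m \<and> length Vs = m \<and>
     (\<forall>V \<in> set Vs. V \<in> carrier_mat n n \<and> elements_mat V \<subseteq> gaussian_rationals) \<and>
     gram_sum n Vs = 1\<^sub>m n"

text \<open>
  The scalar product \<open>\<bullet>\<close> of \<^theory>\<open>Jordan_Normal_Form.Matrix\<close> does not conjugate either argument,
  so the expression below is \<open>x\<^sup>T V y\<close>.
\<close>

fun bilinear_feasible :: "bilinear_system \<Rightarrow> bool" where
  "bilinear_feasible (n, m, Vs) \<longleftrightarrow>
     (\<exists>x \<in> carrier_vec n. \<exists>y \<in> carrier_vec n. x \<noteq> 0\<^sub>v n \<and> y \<noteq> 0\<^sub>v n \<and>
        (\<forall>i < m. x \<bullet> (Vs ! i *\<^sub>v y) = 0))"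

fun enc_bilinear_system :: "bilinear_system \<Rightarrow> bool list" where
  "enc_bilinear_system (n, m, Vs) = enc_nat n @ enc_nat m @ enc_list enc_mat Vs"

definition unital_bilinear_feasibility :: "bilinear_system decision_problem" where
  "unital_bilinear_feasibility =
     \<lparr>instances = Collect unital_system, question = bilinear_feasible,
      encoding = enc_bilinear_system\<rparr>"


section \<open>Injectivity of the encodings\<close>

lemma enc_list_Nil: "enc_list enc [] = [False]"
  by (simp add: enc_list_def)

lemma enc_list_Cons: "enc_list enc (x # xs) = True # enc x @ enc_list enc xs"
  by (simp add: enc_list_def)

lemma enc_list_cancel:
  assumes "\<And>x y u v. x \<in> set xs \<Longrightarrow> y \<in> set ys \<Longrightarrow> enc x @ u = enc y @ v \<Longrightarrow> x = y \<and> u = v"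
    and "enc_list enc xs @ u = enc_list enc ys @ v"
  shows "xs = ys \<and> u = v"
  using assms
proof (induction xs arbitrary: ys)
  case Nil
  then show ?case by (cases ys) (auto simp: enc_list_Nil enc_list_Cons)
next
  case (Cons x xs)
  from Cons.prems(2) obtain y ys' where ys: "ys = y # ys'"
    by (cases ys) (auto simp: enc_list_Nil enc_list_Cons)
  have "enc x @ (enc_list enc xs @ u) = enc y @ (enc_list enc ys' @ v)"
    using Cons.prems(2) by (simp add: ys enc_list_Cons)
  from Cons.prems(1)[OF _ _ this] have "x = y" "enc_list enc xs @ u = enc_list enc ys' @ v"
    by (auto simp: ys)
  with Cons.IH[of ys'] Cons.prems(1) show ?case by (auto simp: ys)
qed

lemma binary_digits_inject: "binary_digits m = binary_digits n \<Longrightarrow> m = n"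
proof (induction m arbitrary: n rule: less_induct)
  case (less m)
  show ?case
  proof (cases "m = 0 \<or> n = 0")
    case True
    with less.prems show ?thesis
      by (auto simp: binary_digits.simps[of m] binary_digits.simps[of n] split: if_splits)
  next
    case False
    with less.prems have "odd m = odd n" "binary_digits (m div 2) = binary_digits (n div 2)"
      by (simp_all add: binary_digits.simps[of m] binary_digits.simps[of n])
    moreover from this(2) have "m div 2 = n div 2" by (rule less.IH[rotated]) (use False in auto)
    ultimately show ?thesis by presburger
  qed
qed

lemma enc_nat_cancel: "enc_nat m @ u = enc_nat n @ v \<Longrightarrow> m = n \<and> u = v"
  unfolding enc_nat_def by (drule enc_list_cancel[rotated]) (auto dest: binary_digits_inject)

lemma enc_int_cancel: "enc_int k @ u = enc_int l @ v \<Longrightarrow> k = l \<and> u = v"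
  unfolding enc_int_def by (auto dest!: enc_nat_cancel split: if_splits)

lemma enc_rat_cancel:
  assumes "enc_rat r @ u = enc_rat s @ v"
  shows "r = s \<and> u = v"
proof -
  obtain a b where r: "quotient_of r = (a, b)" by force
  obtain c d where s: "quotient_of s = (c, d)" by force
  have "b > 0" "d > 0" using r s quotient_of_denom_pos by auto
  with assms have "a = c" "b = d" "u = v"
    by (auto simp: enc_rat_def r s dest!: enc_int_cancel enc_nat_cancel)
  with r s show ?thesis by (metis quotient_of_inject)
qed

lemma enc_complex_cancel:
  assumes "z \<in> gaussian_rationals" "w \<in> gaussian_rationals"
    and "enc_complex z @ u = enc_complex w @ v"
  shows "z = w \<and> u = v"
proof -
  have inv: "the_inv real_of_rat (real_of_rat q) = q" for q
    by (rule the_inv_f_f) (auto intro: injI)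
  from assms(1,2) obtain a b c d where
    "Re z = of_rat a" "Im z = of_rat b" "Re w = of_rat c" "Im w = of_rat d"
    unfolding gaussian_rationals_def Rats_def by auto
  with assms(3) show ?thesis
    by (auto simp: enc_complex_def inv complex_eq_iff dest!: enc_rat_cancel)
qed

lemma mat_to_list_inject:
  assumes "A \<in> carrier_mat n n" "B \<in> carrier_mat n n" "mat_to_list A = mat_to_list B"
  shows "A = B"
proof (rule eq_matI)
  fix i j assume "i < dim_row B" "j < dim_col B"
  moreover have "mat_to_list A ! i ! j = mat_to_list B ! i ! j" by (simp add: assms(3))
  ultimately show "A $$ (i, j) = B $$ (i, j)"
    using assms(1,2) by (auto simp: mat_to_list_def)
qed (use assms in auto)

lemma enc_mat_cancel:
  assumes "A \<in> carrier_mat n n" "elements_mat A \<subseteq> gaussian_rationals"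
    and "B \<in> carrier_mat n n" "elements_mat B \<subseteq> gaussian_rationals"
    and "enc_mat A @ u = enc_mat B @ v"
  shows "A = B \<and> u = v"
proof -
  have *: "z \<in> gaussian_rationals"
    if "elements_mat C \<subseteq> gaussian_rationals" "r \<in> set (mat_to_list C)" "z \<in> set r" for C r z
    using that by (fastforce simp: mat_to_list_def elements_mat_def)
  have rows: "r = s \<and> u' = v'"
    if "r \<in> set (mat_to_list A)" "s \<in> set (mat_to_list B)"
      and eq: "enc_list enc_complex r @ u' = enc_list enc_complex s @ v'" for r s u' v'
    using eq
    by (rule enc_list_cancel[rotated])
      (rule enc_complex_cancel[OF *[OF assms(2) that(1)] *[OF assms(4) that(2)]])
  have "mat_to_list A = mat_to_list B \<and> u = v"
    using assms(5) unfolding enc_mat_def by (rule enc_list_cancel[rotated]) (rule rows)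
  with mat_to_list_inject[OF assms(1,3)] show ?thesis by blast
qed

lemma inj_on_encoding_three_sat: "inj_on (encoding three_sat) (instances three_sat)"
proof (rule inj_onI)
  fix F G assume "encoding three_sat F = encoding three_sat G"
  then have "enc_list enc_clause F @ [] = enc_list enc_clause G @ []"
    by (simp add: three_sat_def)
  then have "F = G \<and> [] = ([] :: bool list)"
    by (rule enc_list_cancel[rotated]) (auto dest!: enc_nat_cancel)
  then show "F = G" ..
qed

lemma inj_on_encoding_unital_bilinear_feasibility:
  "inj_on (encoding unital_bilinear_feasibility) (instances unital_bilinear_feasibility)"
proof (rule inj_onI)
  fix S T
  assume S: "S \<in> instances unital_bilinear_feasibility"
    and T: "T \<in> instances unital_bilinear_feasibility"
    and eq: "encoding unital_bilinear_feasibility S = encoding unital_bilinear_feasibility T"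
  obtain n m Vs where S_eq: "S = (n, m, Vs)" by (cases S)
  obtain n' m' Ws where T_eq: "T = (n', m', Ws)" by (cases T)
  from eq have nm: "n = n'" "m = m'" and "enc_list enc_mat Vs @ [] = enc_list enc_mat Ws @ []"
    by (auto simp: unital_bilinear_feasibility_def S_eq T_eq dest!: enc_nat_cancel)
  from this(3) have "Vs = Ws \<and> [] = ([] :: bool list)"
  proof (rule enc_list_cancel[rotated])
    fix A B u v
    assume "A \<in> set Vs" "B \<in> set Ws" "enc_mat A @ u = enc_mat B @ v"
    then show "A = B \<and> u = v"
      using S T by (intro enc_mat_cancel[of A n B])
        (auto simp: unital_bilinear_feasibility_def S_eq T_eq nm)
  qed
  then show "S = T" by (simp add: S_eq T_eq nm)
qed

end

theory Submission
  imports Defs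
begin

text \<open>
  A formula is written on a tape as a list of symbols, and the coordinates of the bilinear system are
  the tape positions. Coordinate 0 is a homogenizing coordinate, a position at which a literal starts
  says whether that literal is selected, and all other coordinates are forced to vanish. The
  constraints are \<open>x\<^sub>p y\<^sub>q = x\<^sub>q y\<^sub>p\<close>, which make \<open>x\<close> and \<open>y\<close> parallel;
  \<open>x\<^sub>p y\<^sub>q = 0\<close> for conflicting positions, i.e. two literals of one clause or two
  complementary literals; and \<open>(x\<^sub>a + x\<^sub>b + x\<^sub>c - x\<^sub>0) y\<^sub>q = 0\<close> for every clause. A
  solution selects exactly one literal in each clause and no complementary ones.

  Coordinate 1 vanishes in every solution. So where the formula does not impose a constraint,
  its matrix can be replaced by one with an entry 2 in row 1, which makes the Gram sum independent of
  the formula. All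
  matrices have entries in \<open>{0, \<plusminus>1, \<plusminus>2}\<close> and at most one nonzero entry per row, and with
  \<open>n\<^sup>3\<close> matrices of each of the three kinds, those for conflicts taken twice, the Gram sum is
  \<open>16 n\<^sup>2 I\<close>. If \<open>n\<close> is a power
  of two, then so are \<open>n\<close>, the number \<open>4 n\<^sup>3\<close> of matrices and the scaling factor \<open>4 n\<close>, which
  makes their binary codes easy to write.

  The reduction is computed in logarithmic space: the machine only moves several heads over copies
  of the tape, so that its programs are total functions with a running time that is a polynomial of
  the tape length by their nesting of bounded loops.
\<close>

section \<open>Programs on a marked tape and their compilation to Turing machines\<close>

datatype prog =
    Skip
  | Inc nat
  | Dec nat
  | Emit bool
  | Seq prog prog (infixr ";;" 60)
  | Branch nat "nat list" prog prog
  | Down nat prog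

type_synonym store = "nat \<Rightarrow> nat"

definition symbol_at :: "nat list \<Rightarrow> nat \<Rightarrow> nat" where
  "symbol_at tp i = (if i < length tp then tp ! i else 0)"

text \<open>A register is the position of a head on its own copy of \<open>tp\<close>, so
  \<open>Inc\<close> stops at the first blank and \<open>Dec\<close> at 0. \<open>Down\<close> fixes
  its number of rounds on entry, which makes every program total.\<close>

primrec run :: "nat list \<Rightarrow> prog \<Rightarrow> store \<times> bool list \<Rightarrow> store \<times> bool list" where
  "run tp Skip s = s"
| "run tp (Inc r) s = (case s of (h, out) \<Rightarrow>
     (h(r := (if symbol_at tp (h r) = 0 then h r else Suc (h r))), out))"
| "run tp (Dec r) s = (case s of (h, out) \<Rightarrow> (h(r := h r - 1), out))"
| "run tp (Emit b) s = (case s of (h, out) \<Rightarrow> (h, out @ [b]))"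
| "run tp (p ;; q) s = run tp q (run tp p s)"
| "run tp (Branch r S p q) s = (if symbol_at tp (fst s r) \<in> set S then run tp p s else run tp q s)"
| "run tp (Down r p) s =
     ((\<lambda>(h, out). run tp p (h(r := h r - 1), out)) ^^ fst s r) s"

primrec mods :: "prog \<Rightarrow> nat set" where
  "mods Skip = {}"
| "mods (Inc r) = {r}"
| "mods (Dec r) = {r}"
| "mods (Emit b) = {}"
| "mods (p ;; q) = mods p \<union> mods q"
| "mods (Branch r S p q) = mods p \<union> mods q"
| "mods (Down r p) = insert r (mods p)"

text \<open>\<open>run\<close> fixes the rounds of \<open>Down r p\<close> on entry, while the
  compiled machine tests before each round whether head \<open>r\<close> is on the left marker. The
  two agree because the body may not move that head.\<close>

primrec wf_prog :: "nat \<Rightarrow> prog \<Rightarrow> bool" where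
  "wf_prog K Skip \<longleftrightarrow> True"
| "wf_prog K (Inc r) \<longleftrightarrow> r < K"
| "wf_prog K (Dec r) \<longleftrightarrow> r < K"
| "wf_prog K (Emit b) \<longleftrightarrow> True"
| "wf_prog K (p ;; q) \<longleftrightarrow> wf_prog K p \<and> wf_prog K q"
| "wf_prog K (Branch r S p q) \<longleftrightarrow> r < K \<and> wf_prog K p \<and> wf_prog K q"
| "wf_prog K (Down r p) \<longleftrightarrow> r < K \<and> r \<notin> mods p \<and> wf_prog K p"

text \<open>\<open>B\<close> stands for a bound on the tape length and hence on every register.
  Charging both arms of a \<open>Branch\<close> keeps the bound a polynomial in
  \<open>B\<close>.\<close>

primrec cost :: "nat \<Rightarrow> prog \<Rightarrow> nat" where
  "cost B Skip = 1"
| "cost B (Inc r) = 1"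
| "cost B (Dec r) = 1"
| "cost B (Emit b) = 1"
| "cost B (p ;; q) = cost B p + cost B q"
| "cost B (Branch r S p q) = 1 + cost B p + cost B q"
| "cost B (Down r p) = 1 + B * (1 + cost B p)"

lemma cost_poly: "\<exists>P. \<forall>B. cost B p = poly P B"
proof (induction p)
  case (Seq p q)
  then obtain P Q where "\<forall>B. cost B p = poly P B" "\<forall>B. cost B q = poly Q B" by auto
  then show ?case by (intro exI[of _ "P + Q"]) simp
next
  case (Branch r S p q)
  then obtain P Q where "\<forall>B. cost B p = poly P B" "\<forall>B. cost B q = poly Q B" by auto
  then show ?case by (intro exI[of _ "1 + P + Q"]) simp
next
  case (Down r p)
  then obtain P where "\<forall>B. cost B p = poly P B" by auto
  then show ?case by (intro exI[of _ "1 + [:0, 1:] * (1 + P)"]) simp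
qed (auto intro: exI[of _ 1])

section \<open>Compilation of programs into transition tables\<close>

primrec states :: "prog \<Rightarrow> nat" where
  "states Skip = 1"
| "states (Inc r) = 1"
| "states (Dec r) = 1"
| "states (Emit b) = 1"
| "states (p ;; q) = states p + states q"
| "states (Branch r S p q) = 1 + states p + states q"
| "states (Down r p) = 1 + states p"

definition stay :: "nat list \<Rightarrow> (nat \<times> head_move) list" where
  "stay rs = map (\<lambda>s. (s, Stay)) rs"

text \<open>\<open>delta K p s e\<close> occupies the states \<open>s, \<dots>, s + states p - 1\<close>, starts in \<open>s\<close> and leaves to \<open>e\<close>.
  Tape 0 is the input, tape \<open>r + 1\<close> is register \<open>r\<close>, and tape \<open>K + 1\<close> is the output.\<close>

primrec delta ::
  "nat \<Rightarrow> prog \<Rightarrow> nat \<Rightarrow> nat \<Rightarrow> nat \<Rightarrow> nat list \<Rightarrow> nat \<times> (nat \<times> head_move) list" where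
  "delta K Skip s e q rs = (e, stay rs)"
| "delta K (Inc r) s e q rs = (e, if rs ! Suc r = 0 then stay rs
     else (stay rs)[Suc r := (rs ! Suc r, Move_Right)])"
| "delta K (Dec r) s e q rs = (e, if rs ! Suc r = 3 then stay rs
     else (stay rs)[Suc r := (rs ! Suc r, Move_Left)])"
| "delta K (Emit b) s e q rs = (e, (stay rs)[Suc K := (if b then 2 else 1, Move_Right)])"
| "delta K (p ;; p') s e q rs =
     (if q < s + states p then delta K p s (s + states p) q rs
      else delta K p' (s + states p) e q rs)"
| "delta K (Branch r S p p') s e q rs =
     (if q = s then (if rs ! Suc r \<in> set S then Suc s else Suc s + states p, stay rs)
      else if q < Suc s + states p then delta K p (Suc s) e q rs
      else delta K p' (Suc s + states p) e q rs)"
| "delta K (Down r p) s e q rs =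
     (if q = s then
        (if rs ! Suc r = 3 then (e, stay rs)
         else (Suc s, (stay rs)[Suc r := (rs ! Suc r, Move_Left)]))
      else delta K p (Suc s) s q rs)"

lemma states_pos: "0 < states p"
  by (induction p) auto

lemma stay_symbols:
  assumes "set rs \<subseteq> {..<b}"
  shows "\<forall>(c, d) \<in> set (stay rs). c < b"
  using assms by (auto simp: stay_def)

lemma stay_update_symbols:
  assumes "set rs \<subseteq> {..<b}" "c < b"
  shows "\<forall>(c, d) \<in> set ((stay rs)[i := (c, d)]). c < b"
proof -
  have "set ((stay rs)[i := (c, d)]) \<subseteq> insert (c, d) (set (stay rs))"
    by (rule set_update_subset_insert)
  with stay_symbols[OF assms(1)] assms(2) show ?thesis by blast
qed

lemma delta_wf:
  assumes "wf_prog K p" "s \<le> q" "q < s + states p" "s + states p \<le> N" "e < N"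
    and rs: "length rs = Suc (Suc K)" "set rs \<subseteq> {..<b}" and b: "2 < b"
  shows "fst (delta K p s e q rs) < N \<and> length (snd (delta K p s e q rs)) = Suc (Suc K) \<and>
     (\<forall>(c, d) \<in> set (snd (delta K p s e q rs)). c < b)"
proof -
  have len: "length (stay rs) = Suc (Suc K)" using rs by (simp add: stay_def)
  note st = stay_symbols[OF rs(2)] stay_update_symbols[OF rs(2)]
  have nth: "rs ! Suc r < b" if "r < K" for r
    using rs that nth_mem[of "Suc r" rs] by (metis Suc_mono less_SucI lessThan_iff subsetD)
  show ?thesis
    using assms(1-5)
  proof (induction p arbitrary: s e)
    case (Seq p p')
    \<comment> \<open>The exit of the first program is the entry of the second; it lies below
      \<open>N\<close> since every program owns at least one state.\<close>
    have "s + states p < N" using Seq.prems states_pos[of p'] by simp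
    then show ?case using Seq.prems Seq.IH(1)[of s "s + states p"] Seq.IH(2)[of "s + states p" e]
      by simp
  next
    case (Branch r S p p')
    have "Suc s + states p < N" using Branch.prems states_pos[of p'] by simp
    then show ?case
      using Branch.prems Branch.IH(1)[of "Suc s" e] Branch.IH(2)[of "Suc s + states p" e] st(1) len
      by simp
  next
    case (Down r p)
    have "\<forall>(c, d) \<in> set ((stay rs)[Suc r := (rs ! Suc r, Move_Left)]). c < b"
      using Down.prems(1) by (intro st(2) nth) simp
    with Down.prems Down.IH[of "Suc s" s] st(1) len states_pos[of p] show ?case by simp
  next
    case (Emit x)
    have "(if x then 2 else 1) < b" using b by simp
    from st(2)[OF this] show ?case using Emit len by simp
  qed (use st(1) st(2)[OF nth] len in simp_all)
qed

section \<open>Simulation of a program by its machine\<close>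

definition contents :: "nat list \<Rightarrow> int \<Rightarrow> nat" where
  "contents xs i = (if 0 \<le> i \<and> i < int (length xs) then xs ! nat i else 0)"

lemma contents_int: "contents xs (int k) = symbol_at xs k"
  by (simp add: contents_def symbol_at_def)

lemma contents_length: "contents xs (int (length xs)) = 0"
  by (simp add: contents_def)

lemma contents_append:
  "(contents xs)(int (length xs) := c) = contents (xs @ [c])"
proof
  fix i
  show "((contents xs)(int (length xs) := c)) i = contents (xs @ [c]) i"
    by (cases "i < 0"; cases "nat i" "length xs" rule: linorder_cases)
      (auto simp: contents_def nth_append)
qed

lemma word_contents_eq: "word_contents w = contents (map (\<lambda>b. if b then 2 else 1) w)"
  by (auto simp: word_contents_def contents_def fun_eq_iff)

text \<open>Tape 0 is left free because \<open>delta\<close> inspects only the register tapes. The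
  output head stands on the first blank behind the output, where \<open>Emit\<close> writes.\<close>

definition represents ::
  "nat \<Rightarrow> nat list \<Rightarrow> store \<times> bool list \<Rightarrow> tape list \<Rightarrow> bool" where
  "represents K tp s ts \<longleftrightarrow> length ts = Suc (Suc K) \<and>
     (\<forall>r < K. ts ! Suc r = (contents tp, int (fst s r))) \<and>
     ts ! Suc K = (word_contents (snd s), int (length (snd s)))"

definition reaches :: "tm \<Rightarrow> nat \<Rightarrow> tm_config \<Rightarrow> tm_config \<Rightarrow> bool" where
  "reaches M t c c' \<longleftrightarrow> (\<exists>t' \<le> t. (tm_step M ^^ t') c = c')"

lemma reaches_refl: "reaches M t c c"
  unfolding reaches_def by (intro exI[of _ 0]) simp

lemma reaches_trans:
  assumes "reaches M t c c'" "reaches M u c' c''" "t + u \<le> v"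
  shows "reaches M v c c''"
proof -
  from assms(1,2) obtain t' u' where "t' \<le> t" "u' \<le> u"
    "(tm_step M ^^ t') c = c'" "(tm_step M ^^ u') c' = c''"
    unfolding reaches_def by auto
  then have "(tm_step M ^^ (u' + t')) c = c''" by (simp add: funpow_add)
  with assms(3) \<open>t' \<le> t\<close> \<open>u' \<le> u\<close> show ?thesis
    unfolding reaches_def by (intro exI[of _ "u' + t'"]) simp
qed

lemma reaches_step: "tm_step M c = c' \<Longrightarrow> 1 \<le> t \<Longrightarrow> reaches M t c c'"
  unfolding reaches_def by (intro exI[of _ 1]) simp

lemma tm_step_trans:
  assumes "tm_trans M q (map scanned ts) = (q', as)" "2 \<le> q"
  shows "tm_step M (q, ts) = (q', map2 act_on_tape as ts)"
  using assms by simp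

declare tm_step.simps [simp del]

lemma act_stay: "map2 act_on_tape (stay (map scanned ts)) ts = ts"
  proof (rule nth_equalityI)
  fix j assume "j < length (map2 act_on_tape (stay (map scanned ts)) ts)"
  then show "map2 act_on_tape (stay (map scanned ts)) ts ! j = ts ! j"
    by (cases "ts ! j") (simp add: stay_def)
qed (simp add: stay_def)

lemma act_stay_update:
  "map2 act_on_tape ((stay (map scanned ts))[i := a]) ts = ts[i := act_on_tape a (ts ! i)]"
proof (rule nth_equalityI)
  fix j assume "j < length (map2 act_on_tape ((stay (map scanned ts))[i := a]) ts)"
  then have "j < length ts" by (simp add: stay_def)
  then show "map2 act_on_tape ((stay (map scanned ts))[i := a]) ts ! j
      = ts[i := act_on_tape a (ts ! i)] ! j"
    by (cases "ts ! j"; cases "i = j") (auto simp: stay_def)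
qed (simp add: stay_def)

text \<open>Only transitions from the block of states owned by \<open>p\<close> are prescribed, so
  the blocks of subprograms inherit the property.\<close>

definition implements :: "nat \<Rightarrow> tm \<Rightarrow> prog \<Rightarrow> nat \<Rightarrow> nat \<Rightarrow> bool" where
  "implements K M p s e \<longleftrightarrow> (\<forall>q rs. s \<le> q \<and> q < s + states p \<and> length rs = Suc (Suc K) \<longrightarrow>
     tm_trans M q rs = delta K p s e q rs)"

text \<open>These are the two tests that a machine can make on a head: being at the left end, and
  having run off the right end.\<close>

locale marked_tape =
  fixes tp :: "nat list"
  assumes symbol_at_3_iff: "symbol_at tp i = 3 \<longleftrightarrow> i = 0"
    and symbol_at_0_iff: "symbol_at tp i = 0 \<longleftrightarrow> length tp \<le> i"
begin

text \<open>Position \<open>length tp\<close> is already blank, and \<open>Inc\<close> does not move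
  on a blank.\<close>

lemma run_bounded:
  assumes "fst s r \<le> length tp"
  shows "fst (run tp p s) r \<le> length tp"
  using assms
proof (induction p arbitrary: s)
  case (Down r' p)
  define f where "f = (\<lambda>(h, out). run tp p (h(r' := h r' - 1), out))"
  have "fst (f s) r \<le> length tp" if "fst s r \<le> length tp" for s
    unfolding f_def using that by (auto split: prod.split intro!: Down.IH)
  then have "fst ((f ^^ k) s) r \<le> length tp" for k
    by (induction k) (simp_all add: Down.prems)
  then show ?case by (simp add: f_def)
qed (auto split: prod.splits simp: symbol_at_0_iff)

lemma run_unmodified: "r \<notin> mods p \<Longrightarrow> fst (run tp p s) r = fst s r"
proof (induction p arbitrary: s)
  case (Down r' p)
  define f where "f = (\<lambda>(h, out). run tp p (h(r' := h r' - 1), out))"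
  have "fst (f s) r = fst s r" for s
    unfolding f_def using Down by (simp split: prod.split)
  then have "fst ((f ^^ k) s) r = fst s r" for k
    by (induction k) simp_all
  then show ?case by (simp add: f_def)
qed (auto split: prod.splits)

lemma represents_scanned:
  assumes "represents K tp s ts" "r < K"
  shows "map scanned ts ! Suc r = symbol_at tp (fst s r)"
  using assms by (simp add: represents_def contents_int)

lemma represents_move:
  assumes "represents K tp (h, out) ts" "r < K" "int (h r) + head_offset d = int v"
  shows "represents K tp (h(r := v), out) (ts[Suc r := act_on_tape (map scanned ts ! Suc r, d) (ts ! Suc r)])"
  using assms by (auto simp: represents_def contents_int nth_list_update)

lemma represents_emit:
  assumes "represents K tp (h, out) ts"
  shows "represents K tp (h, out @ [b])
    (ts[Suc K := act_on_tape (if b then 2 else 1, Move_Right) (ts ! Suc K)])"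
proof -
  have "(word_contents out)(int (length out) := (if b then 2 else 1)) = word_contents (out @ [b])"
    using contents_append[of "map (\<lambda>b. if b then 2 else 1) out"] by (simp add: word_contents_eq)
  then show ?thesis using assms by (auto simp: represents_def nth_list_update)
qed

text \<open>Induction on the program; only \<open>Down\<close> needs a second induction. The bounds
  on the heads enter because a loop makes as many rounds as its head is away from the left
  end.\<close>

lemma simulation:
  assumes "implements K M p s e" "2 \<le> s" "wf_prog K p"
    and "represents K tp st ts" "\<forall>r<K. fst st r \<le> length tp" "length tp \<le> B"
  shows "\<exists>ts'. reaches M (cost B p) (s, ts) (e, ts') \<and> represents K tp (run tp p st) ts'"
  using assms
proof (induction p arbitrary: s e st ts)
  case Skip
  then have "tm_trans M s (map scanned ts) = (e, stay (map scanned ts))"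
    by (auto simp: implements_def represents_def)
  then have "tm_step M (s, ts) = (e, ts)" using tm_step_trans Skip(2) by (fastforce simp: act_stay)
  then show ?case using Skip(4) by (intro exI[of _ ts]) (simp add: reaches_step)
next
  case (Inc r)
  obtain h out where st: "st = (h, out)" by force
  let ?rs = "map scanned ts"
  have *: "tm_trans M s ?rs = delta K (Inc r) s e s ?rs"
    using Inc.prems by (auto simp: implements_def represents_def)
  have sc: "?rs ! Suc r = symbol_at tp (h r)"
    using represents_scanned[of K st ts r] Inc.prems st by simp
  show ?case
  proof (cases "symbol_at tp (h r) = 0")
    case True
    then have "tm_step M (s, ts) = (e, ts)" using Inc.prems(2) * sc by (simp add: tm_step_trans act_stay)
    moreover have "h(r := h r) = h" by simp
    ultimately show ?thesis using True Inc.prems(4) st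
      by (intro exI[of _ ts]) (simp add: reaches_step)
  next
    case False
    let ?ts = "ts[Suc r := act_on_tape (?rs ! Suc r, Move_Right) (ts ! Suc r)]"
    have "tm_step M (s, ts) = (e, ?ts)"
      using Inc.prems(2) * sc False by (simp add: tm_step_trans act_stay_update)
    moreover have "represents K tp (h(r := Suc (h r)), out) ?ts"
      using Inc.prems by (intro represents_move) (auto simp: st)
    ultimately show ?thesis using False st by (intro exI[of _ ?ts]) (simp add: reaches_step)
  qed
next
  case (Dec r)
  obtain h out where st: "st = (h, out)" by force
  let ?rs = "map scanned ts"
  have *: "tm_trans M s ?rs = delta K (Dec r) s e s ?rs"
    using Dec.prems by (auto simp: implements_def represents_def)
  have sc: "?rs ! Suc r = symbol_at tp (h r)"
    using represents_scanned[of K st ts r] Dec.prems st by simp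
  show ?case
  proof (cases "h r = 0")
    case True
    then have "symbol_at tp (h r) = 3" by (simp add: symbol_at_3_iff)
    then have "tm_step M (s, ts) = (e, ts)" using Dec.prems(2) * sc by (simp add: tm_step_trans act_stay)
    moreover have "h(r := 0) = h" using True by auto
    ultimately show ?thesis using True Dec.prems(4) st
      by (intro exI[of _ ts]) (simp add: reaches_step)
  next
    case False
    then have f: "symbol_at tp (h r) \<noteq> 3" by (simp add: symbol_at_3_iff)
    let ?ts = "ts[Suc r := act_on_tape (?rs ! Suc r, Move_Left) (ts ! Suc r)]"
    have "tm_step M (s, ts) = (e, ?ts)"
      using Dec.prems(2) * sc f by (simp add: tm_step_trans act_stay_update)
    moreover have "represents K tp (h(r := h r - 1), out) ?ts"
      using Dec.prems False by (intro represents_move) (auto simp: st)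
    ultimately show ?thesis using st by (intro exI[of _ ?ts]) (simp add: reaches_step)
  qed
next
  case (Emit b)
  obtain h out where st: "st = (h, out)" by force
  let ?ts = "ts[Suc K := act_on_tape (if b then 2 else 1, Move_Right) (ts ! Suc K)]"
  have "tm_trans M s (map scanned ts) = delta K (Emit b) s e s (map scanned ts)"
    using Emit.prems by (auto simp: implements_def represents_def)
  then have "tm_step M (s, ts) = (e, ?ts)"
    using Emit.prems(2) by (simp add: tm_step_trans act_stay_update)
  moreover have "represents K tp (h, out @ [b]) ?ts"
    using Emit.prems represents_emit st by blast
  ultimately show ?case using st by (intro exI[of _ ?ts]) (simp add: reaches_step)
next
  case (Seq p q)
  have ip: "implements K M p s (s + states p)" and iq: "implements K M q (s + states p) e"
    using Seq.prems(1) by (auto simp: implements_def)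
  from Seq.IH(1)[OF ip Seq.prems(2) _ Seq.prems(4-6)] Seq.prems(3)
  obtain ts1 where 1: "reaches M (cost B p) (s, ts) (s + states p, ts1)"
    "represents K tp (run tp p st) ts1" by auto
  have "\<forall>r<K. fst (run tp p st) r \<le> length tp" using Seq.prems(5) run_bounded by auto
  from Seq.IH(2)[OF iq _ _ 1(2) this Seq.prems(6)] Seq.prems(2,3)
  obtain ts2 where 2: "reaches M (cost B q) (s + states p, ts1) (e, ts2)"
    "represents K tp (run tp q (run tp p st)) ts2" by auto
  with reaches_trans[OF 1(1) 2(1)] show ?case by auto
next
  case (Branch r S p q)
  have ip: "implements K M p (Suc s) e" and iq: "implements K M q (Suc s + states p) e"
    using Branch.prems(1) by (auto simp: implements_def)
  have "tm_trans M s (map scanned ts) = delta K (Branch r S p q) s e s (map scanned ts)"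
    using Branch.prems by (auto simp: implements_def represents_def)
  moreover have sc: "map scanned ts ! Suc r = symbol_at tp (fst st r)"
    using represents_scanned[of K st ts r] Branch.prems by simp
  ultimately have step: "tm_step M (s, ts) =
      (if symbol_at tp (fst st r) \<in> set S then Suc s else Suc s + states p, ts)"
    using Branch.prems(2) by (simp add: tm_step_trans act_stay)
  show ?case
  proof (cases "symbol_at tp (fst st r) \<in> set S")
    case True
    with step have 1: "reaches M 1 (s, ts) (Suc s, ts)" by (simp add: reaches_step)
    from Branch.IH(1)[OF ip _ _ Branch.prems(4-6)] Branch.prems(2,3) obtain ts' where
      "reaches M (cost B p) (Suc s, ts) (e, ts')" "represents K tp (run tp p st) ts'" by auto
    with reaches_trans[OF 1 this(1), of "cost B (Branch r S p q)"] True show ?thesis by auto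
  next
    case False
    with step have 1: "reaches M 1 (s, ts) (Suc s + states p, ts)" by (simp add: reaches_step)
    from Branch.IH(2)[OF iq _ _ Branch.prems(4-6)] Branch.prems(2,3) obtain ts' where
      "reaches M (cost B q) (Suc s + states p, ts) (e, ts')" "represents K tp (run tp q st) ts'"
      by auto
    with reaches_trans[OF 1 this(1), of "cost B (Branch r S p q)"] False show ?thesis by auto
  qed
next
  case (Down r p)
  let ?f = "\<lambda>(h, out). run tp p (h(r := h r - 1), out)"
  have ip: "implements K M p (Suc s) s"
    using Down.prems(1) by (auto simp: implements_def)
  have r: "r < K" "r \<notin> mods p" "wf_prog K p" using Down.prems by auto
  \<comment> \<open>Inner induction on the number \<open>k\<close> of rounds left, which is also the
    head position. A round costs one move plus the body, and the additional 1 pays for the test that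
    finds the marker.\<close>
  have loop: "\<exists>ts'. reaches M (1 + k * (1 + cost B p)) (s, ts) (e, ts') \<and>
      represents K tp ((?f ^^ k) st) ts'"
    if "represents K tp st ts" "\<forall>r<K. fst st r \<le> length tp" "fst st r = k" for k st ts
    using that
  proof (induction k arbitrary: st ts)
    case 0
    have "tm_trans M s (map scanned ts) = delta K (Down r p) s e s (map scanned ts)"
      using Down.prems(1) 0 by (auto simp: implements_def represents_def)
    moreover have "map scanned ts ! Suc r = 3"
      using represents_scanned[OF 0(1) r(1)] 0 by (simp add: symbol_at_3_iff)
    ultimately have "tm_step M (s, ts) = (e, ts)"
      using Down.prems(2) by (simp add: tm_step_trans act_stay)
    then show ?case using 0 by (intro exI[of _ ts]) (simp add: reaches_step)
  next
    case (Suc k)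
    obtain h out where st: "st = (h, out)" by force
    let ?ts = "ts[Suc r := act_on_tape (map scanned ts ! Suc r, Move_Left) (ts ! Suc r)]"
    have "tm_trans M s (map scanned ts) = delta K (Down r p) s e s (map scanned ts)"
      using Down.prems(1) Suc.prems by (auto simp: implements_def represents_def)
    moreover have "map scanned ts ! Suc r \<noteq> 3"
      using represents_scanned[OF Suc.prems(1) r(1)] Suc.prems by (simp add: symbol_at_3_iff)
    ultimately have "tm_step M (s, ts) = (Suc s, ?ts)"
      using Down.prems(2) by (simp add: tm_step_trans act_stay_update)
    then have 1: "reaches M 1 (s, ts) (Suc s, ?ts)" by (simp add: reaches_step)
    have rep: "represents K tp (h(r := h r - 1), out) ?ts"
      using Suc.prems r(1) by (intro represents_move) (auto simp: st)
    have "\<forall>r'<K. fst (h(r := h r - 1), out) r' \<le> length tp" using Suc.prems st by auto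
    from Down.IH[OF ip _ r(3) rep this Down.prems(6)] Down.prems(2) obtain ts1 where
      2: "reaches M (cost B p) (Suc s, ?ts) (s, ts1)" "represents K tp (?f st) ts1"
      using st by auto
    have "\<forall>r'<K. fst (?f st) r' \<le> length tp"
      using Suc.prems(2) unfolding st prod.case
      by (intro allI impI run_bounded) (auto intro: le_SucI)
    \<comment> \<open>The body leaves head \<open>r\<close> alone, so exactly \<open>k\<close>
      rounds remain and the inner hypothesis applies.\<close>
    moreover have "fst (?f st) r = k" using run_unmodified[OF r(2)] Suc.prems(3) st by simp
    ultimately obtain ts2 where
      3: "reaches M (1 + k * (1 + cost B p)) (s, ts1) (e, ts2)"
         "represents K tp ((?f ^^ k) (?f st)) ts2"
      using Suc.IH[OF 2(2)] by blast
    have "reaches M (1 + cost B p) (s, ts) (s, ts1)" using reaches_trans[OF 1 2(1)] by simp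
    from reaches_trans[OF this 3(1), of "1 + Suc k * (1 + cost B p)"]
    have "reaches M (1 + Suc k * (1 + cost B p)) (s, ts) (e, ts2)" by (simp add: algebra_simps)
    moreover have "(?f ^^ Suc k) st = (?f ^^ k) (?f st)"
      unfolding funpow_Suc_right comp_apply ..
    ultimately show ?case using 3(2) by (intro exI[of _ ts2] conjI) (simp_all only:)
  qed
  obtain ts' where *: "reaches M (1 + fst st r * (1 + cost B p)) (s, ts) (e, ts')"
      "represents K tp (run tp (Down r p) st) ts'"
    using loop[OF Down.prems(4,5) refl] by auto
  have "fst st r \<le> B" using Down.prems(5,6) r(1) by force
  then have "reaches M (cost B (Down r p)) (s, ts) (e, ts')"
    by (intro reaches_trans[OF *(1) reaches_refl[of M 0]]) (simp add: add_mono mult_le_mono)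
  with *(2) show ?case by blast
qed

end

section \<open>Translation of the input bits into the formula tape\<close>

text \<open>Tape symbols: 0 blank, 3 left end marker, 4 a dummy coordinate, 5 start of a clause, 6 and 7 start
  of a negative or positive literal, 8 and 9 the binary digits of its variable, 10 padding.\<close>

fun literal_symbols :: "literal \<Rightarrow> nat list" where
  "literal_symbols (s, v) = (if s then 7 else 6) # map (\<lambda>b. if b then 9 else 8) (binary_digits v)"

fun clause_symbols :: "clause3 \<Rightarrow> nat list" where
  "clause_symbols (a, b, c) = 5 # literal_symbols a @ literal_symbols b @ literal_symbols c"

text \<open>The padding is as long as the input, so the clauses fill less than half of the tape. The
  largest power of two below the tape length therefore still covers all of them.\<close>

definition formula_tape :: "clause3 list \<Rightarrow> nat list" where
  "formula_tape F =
     [3, 4] @ concat (map clause_symbols F) @ replicate (length (enc_list enc_clause F)) 10"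

text \<open>States 1, 4, 7 expect the sign of a literal, states 2, 5, 8 the tag and states 3, 6, 9 the value
  of a digit; state 0 expects the tag of a clause.\<close>

definition transduce_bit :: "nat \<Rightarrow> bool \<Rightarrow> nat \<times> nat list" where
  "transduce_bit q b =
     (if q = 0 then (if b then (1, [5]) else (10, []))
      else if q \<in> {1, 4, 7} then (Suc q, [if b then 7 else 6])
      else if q \<in> {2, 5, 8} then (if b then Suc q else if q = 8 then 0 else q + 2, [])
      else (q - 1, [if b then 9 else 8]))"

fun transduce :: "nat \<Rightarrow> bool list \<Rightarrow> nat \<times> nat list" where
  "transduce q [] = (q, [])"
| "transduce q (b # bs) = (case transduce_bit q b of (q', xs) \<Rightarrow>
     (case transduce q' bs of (q'', ys) \<Rightarrow> (q'', xs @ ys)))"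

lemma transduce_append:
  "transduce q (u @ v) = (case transduce q u of (q', xs) \<Rightarrow>
     (case transduce q' v of (q'', ys) \<Rightarrow> (q'', xs @ ys)))"
  by (induction u arbitrary: q) (auto split: prod.splits)

text \<open>The code of a number alternates tags and digits, so the transducer switches between
  \<open>q\<close> and \<open>q + 1\<close>. The closing tag leads to the sign of the next literal,
  or after the third literal back to state 0.\<close>

lemma transduce_nat:
  assumes "q \<in> {2, 5, 8}"
  shows "transduce q (enc_nat v) =
    (if q = 8 then 0 else q + 2, map (\<lambda>b. if b then 9 else 8) (binary_digits v))"
proof -
  have "transduce q (enc_list (\<lambda>b. [b]) bs) =
      (if q = 8 then 0 else q + 2, map (\<lambda>b. if b then 9 else 8) bs)" for bs
  proof (induction bs)
    case (Cons b bs)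
    have "transduce_bit q True = (Suc q, [])" "transduce_bit (Suc q) b = (q, [if b then 9 else 8])"
      using assms by (elim insertE emptyE; simp add: transduce_bit_def)+
    then show ?case by (simp add: enc_list_Cons Cons.IH)
  qed (use assms in \<open>auto simp: enc_list_Nil transduce_bit_def\<close>)
  then show ?thesis unfolding enc_nat_def .
qed

lemma transduce_literal:
  assumes "q \<in> {1, 4, 7}"
  shows "transduce q (enc_literal l) = (if q = 7 then 0 else q + 3, literal_symbols l)"
  using assms by (cases l) (auto simp: transduce_nat transduce_bit_def)

lemma transduce_clause: "transduce 1 (enc_clause C) = (0, tl (clause_symbols C))"
  by (cases C)
    (simp add: transduce_append transduce_literal del: enc_literal.simps literal_symbols.simps)

lemma transduce_formula:
  "transduce 0 (enc_list enc_clause F) = (10, concat (map clause_symbols F))"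
proof (induction F)
  case (Cons C F)
  obtain xs where xs: "clause_symbols C = 5 # xs" by (cases C) simp
  have "transduce_bit 0 True = (1, [5])" by (simp add: transduce_bit_def)
  moreover have "transduce 1 (enc_clause C) = (0, xs)" by (simp only: transduce_clause xs list.sel)
  ultimately show ?case
    by (simp add: enc_list_Cons transduce_append Cons xs del: One_nat_def)
qed (simp add: enc_list_Nil transduce_bit_def)

lemma transduce_bit_le: "q \<le> 10 \<Longrightarrow> fst (transduce_bit q b) \<le> 10"
  by (auto simp: transduce_bit_def)

lemma transduce_bit_symbols: "set (snd (transduce_bit q b)) \<subseteq> {..<11}"
  by (auto simp: transduce_bit_def)

text \<open>With at most one symbol per bit, one machine step can process one input bit.\<close>

lemma transduce_bit_length: "length (snd (transduce_bit q b)) \<le> 1"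
  by (auto simp: transduce_bit_def)

section \<open>The full machine: preparation of the tapes, then the program\<close>

definition append_act :: "nat \<Rightarrow> head_move \<Rightarrow> nat list \<Rightarrow> nat list \<Rightarrow> (nat \<times> head_move) list" where
  "append_act K d xs rs =
     (rs ! 0, d) # map (\<lambda>s. if xs = [] then (s, Stay) else (hd xs, Move_Right)) (take K (tl rs))
       @ [(rs ! Suc K, Stay)]"

text \<open>State 1 halts and is skipped: 0 and 2 write the symbols 3 and 4, state
  \<open>q + 3\<close> is state \<open>q\<close> of the transducer, 14 walks back over the input and
  writes one padding symbol per bit, and the program owns the states from 15 on, with exit
  1.\<close>

definition machine :: "nat \<Rightarrow> prog \<Rightarrow> tm" where
  "machine K p = \<lparr>tm_tapes = Suc (Suc K), tm_symbols = 11, tm_states = 15 + states p,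
     tm_trans = \<lambda>q rs.
       if q = 0 then (2, append_act K Stay [3] rs)
       else if q = 2 then (3, append_act K Stay [4] rs)
       else if q < 14 then if rs ! 0 = 0 then (14, append_act K Move_Left [] rs) else
         (fst (transduce_bit (q - 3) (rs ! 0 = 2)) + 3,
          append_act K Move_Right (snd (transduce_bit (q - 3) (rs ! 0 = 2))) rs)
       else if q = 14 then
         (if rs ! 0 = 0 then (15, append_act K Stay [] rs) else (14, append_act K Move_Left [10] rs))
       else delta K p 15 1 q rs\<rparr>"

lemma append_act_wf:
  assumes "length rs = Suc (Suc K)" "set rs \<subseteq> {..<b}" "set xs \<subseteq> {..<b}"
  shows "length (append_act K d xs rs) = Suc (Suc K) \<and> (\<forall>(c, d) \<in> set (append_act K d xs rs). c < b)"
proof -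
  have "rs ! i < b" if "i < Suc (Suc K)" for i
    using assms(1,2) nth_mem[of i rs] that by (metis lessThan_iff subsetD)
  then have "rs ! 0 < b" "rs ! Suc K < b" by simp_all
  moreover have "set (take K (tl rs)) \<subseteq> {..<b}"
    using assms(2) set_take_subset[of K "tl rs"] list.set_sel(2)[of rs] by (cases rs) auto
  moreover have "xs \<noteq> [] \<Longrightarrow> hd xs < b" using assms(3) hd_in_set by blast
  ultimately show ?thesis using assms(1) by (auto simp: append_act_def split: if_splits)
qed

lemma wf_machine: assumes "wf_prog K p" shows "wf_tm (machine K p)"
proof -
  have *: "fst (tm_trans (machine K p) q rs) < 15 + states p \<and>
      length (snd (tm_trans (machine K p) q rs)) = Suc (Suc K) \<and>
      (\<forall>(c, d) \<in> set (snd (tm_trans (machine K p) q rs)). c < 11)"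
    if q: "q < 15 + states p" and rs: "length rs = Suc (Suc K)" "set rs \<subseteq> {..<11}" for q rs
  proof -
    have wf: "length (append_act K d xs rs) = Suc (Suc K)"
      "\<forall>(c, d) \<in> set (append_act K d xs rs). c < 11" if "set xs \<subseteq> {..<11}" for d xs
      using append_act_wf[OF rs that] by auto
    have *: "fst (transduce_bit (q - 3) b) < 12 + states p" if "q < 14" for b
      using transduce_bit_le[of "q - 3" b] that states_pos[of p] by linarith
    show ?thesis
    proof (cases "q < 15")
      case True
      then consider "q = 0" | "q = 2" | "q < 14" "q \<noteq> 0" "q \<noteq> 2" | "q = 14"
        by linarith
      then show ?thesis
        using wf[of "[3]"] wf[of "[4]"] wf[of "[]"] wf[of "[10]"] * states_pos[of p]
          wf[OF transduce_bit_symbols]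
        by cases (simp_all add: machine_def)
    next
      case False
      with delta_wf[OF assms, of 15 q "15 + states p" 1 rs 11] q rs show ?thesis
        by (simp add: machine_def)
    qed
  qed
  have sel: "tm_tapes (machine K p) = Suc (Suc K)" "tm_symbols (machine K p) = 11"
    "tm_states (machine K p) = 15 + states p"
    by (simp_all add: machine_def)
  show ?thesis
    unfolding wf_tm_def sel case_prod_beta
  proof (intro conjI allI impI)
    fix q rs
    assume q: "q < 15 + states p" and "length rs = Suc (Suc K) \<and> set rs \<subseteq> {..<11 :: nat}"
    then have rs: "length rs = Suc (Suc K)" "set rs \<subseteq> {..<11}" by simp_all
    note ** = *[OF q rs]
    show "fst (tm_trans (machine K p) q rs) < 15 + states p" using ** by simp
    show "length (snd (tm_trans (machine K p) q rs)) = Suc (Suc K)" using ** by simp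
    show "\<forall>x \<in> set (snd (tm_trans (machine K p) q rs)). fst x < 11"
      using ** by (simp add: case_prod_beta)
  qed simp_all
qed

text \<open>The register heads stand behind the last symbol written. This is why programs start with
  every register equal to \<open>length tp\<close>.\<close>

definition copy_tapes :: "nat \<Rightarrow> bool list \<Rightarrow> int \<Rightarrow> nat list \<Rightarrow> tape list" where
  "copy_tapes K w i xs = (word_contents w, i) # replicate K (contents xs, int (length xs))
     @ [(word_contents [], 0)]"

lemma scanned_copy_tapes: "map scanned (copy_tapes K w i xs) = word_contents w i # replicate K 0 @ [0]"
  by (simp add: copy_tapes_def contents_length) (simp add: word_contents_def)

text \<open>All \<open>K\<close> copies grow in the same step, so giving each register its own tape
  costs no extra time.\<close>

lemma act_append_act:
  assumes "length ys \<le> 1"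
  shows "map2 act_on_tape (append_act K d ys (map scanned (copy_tapes K w i xs))) (copy_tapes K w i xs)
    = copy_tapes K w (i + head_offset d) (xs @ ys)"
proof (cases ys)
  case Nil
  have "(contents xs)(int (length xs) := 0) = contents xs"
    by (auto simp: contents_length fun_eq_iff)
  moreover have "(word_contents [])(0 := 0) = word_contents []"
    by (auto simp: word_contents_def fun_eq_iff)
  ultimately show ?thesis unfolding scanned_copy_tapes
    by (simp add: Nil append_act_def copy_tapes_def zip_append zip_replicate nth_append)
next
  case (Cons c cs)
  then have ys: "ys = [c]" using assms by simp
  moreover have "(word_contents [])(0 := 0) = word_contents []"
    by (auto simp: word_contents_def fun_eq_iff)
  ultimately show ?thesis unfolding scanned_copy_tapes
    by (simp add: append_act_def copy_tapes_def zip_append zip_replicate nth_append contents_append)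
qed

lemma machine_append_step:
  assumes "tm_trans (machine K p) q (map scanned (copy_tapes K w i xs))
      = (q', append_act K d ys (map scanned (copy_tapes K w i xs)))" "q \<noteq> 1" "length ys \<le> 1"
    and "i' = i + head_offset d"
  shows "reaches (machine K p) 1 (q, copy_tapes K w i xs) (q', copy_tapes K w i' (xs @ ys))"
  using assms act_append_act[OF assms(3)] by (intro reaches_step) (simp_all add: tm_step.simps)

lemma machine_transduce:
  assumes "w = u @ v" "q \<le> 10"
  shows "reaches (machine K p) (length v) (q + 3, copy_tapes K w (int (length u)) xs)
    (fst (transduce q v) + 3, copy_tapes K w (int (length w)) (xs @ snd (transduce q v)))"
  using assms
proof (induction v arbitrary: q u xs)
  case Nil
  then show ?case by (auto simp: reaches_refl)
next
  case (Cons b v)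
  obtain q1 zs where 1: "transduce_bit q b = (q1, zs)" by force
  obtain q2 ys where 2: "transduce q1 v = (q2, ys)" by force
  let ?rs = "map scanned (copy_tapes K w (int (length u)) xs)"
  have "?rs ! 0 = (if b then 2 else 1)"
    using Cons.prems(1) by (simp add: scanned_copy_tapes word_contents_def)
  then have "reaches (machine K p) 1 (q + 3, copy_tapes K w (int (length u)) xs)
    (q1 + 3, copy_tapes K w (int (length (u @ [b]))) (xs @ zs))"
    using 1 Cons.prems(2) transduce_bit_length[of q b]
    by (intro machine_append_step[where d = Move_Right])
      (simp_all add: machine_def split del: if_split, cases b, simp_all)
  moreover have "reaches (machine K p) (length v)
    (q1 + 3, copy_tapes K w (int (length (u @ [b]))) (xs @ zs))
    (q2 + 3, copy_tapes K w (int (length w)) ((xs @ zs) @ ys))"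
    using Cons.IH[of "u @ [b]" q1 "xs @ zs"] Cons.prems transduce_bit_le[of q b] 1 2 by simp
  ultimately show ?case using 1 2 by (auto elim: reaches_trans)
qed

text \<open>With the head at \<open>k - 1\<close>, there are \<open>k\<close> input symbols left to
  pass; the extra step reads the blank at \<open>- 1\<close>.\<close>

lemma machine_pad:
  assumes "k \<le> length w"
  shows "reaches (machine K p) (Suc k) (14, copy_tapes K w (int k - 1) xs)
    (15, copy_tapes K w (- 1) (xs @ replicate k 10))"
  using assms
proof (induction k arbitrary: xs)
  case 0
  have "map scanned (copy_tapes K w (- 1) xs) ! 0 = 0"
    by (simp add: scanned_copy_tapes word_contents_def)
  then have "reaches (machine K p) 1 (14, copy_tapes K w (- 1) xs)
      (15, copy_tapes K w (- 1) (xs @ []))"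
    by (intro machine_append_step[where d = Stay]) (simp_all add: machine_def)
  then show ?case by simp
next
  case (Suc k)
  have "map scanned (copy_tapes K w (int k) xs) ! 0 \<noteq> 0"
    using Suc.prems by (simp add: scanned_copy_tapes word_contents_def)
  then have "reaches (machine K p) 1 (14, copy_tapes K w (int k) xs)
      (14, copy_tapes K w (int k - 1) (xs @ [10]))"
    by (intro machine_append_step[where d = Move_Left]) (simp_all add: machine_def)
  moreover have "reaches (machine K p) (Suc k) (14, copy_tapes K w (int k - 1) (xs @ [10]))
      (15, copy_tapes K w (- 1) ((xs @ [10]) @ replicate k 10))"
    using Suc.IH[of "xs @ [10]"] Suc.prems by simp
  ultimately show ?case by (auto elim: reaches_trans)
qed

text \<open>The steps are 2 for the symbols 3 and 4, one per bit, 1 for turning back at the right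
  end, and one per bit plus 1 for the padding.\<close>

lemma machine_prepare:
  defines "w \<equiv> \<lambda>F. enc_list enc_clause F"
  shows "reaches (machine K p) (2 * length (w F) + 4) (tm_init (machine K p) (w F))
    (15, copy_tapes K (w F) (- 1) (formula_tape F))"
proof -
  let ?M = "machine K p" and ?L = "length (w F)" and ?T = "copy_tapes K (w F)"
  have init: "tm_init ?M (w F) = (0, ?T 0 [])"
    by (simp add: tm_init_def machine_def copy_tapes_def word_contents_eq replicate_append_same)
  have 1: "reaches ?M 1 (0, ?T 0 []) (2, ?T 0 ([] @ [3]))"
    by (rule machine_append_step[where d = Stay]) (simp_all add: machine_def)
  have 2: "reaches ?M 1 (2, ?T 0 [3]) (0 + 3, ?T (int (length ([] :: bool list))) ([3] @ [4]))"
    by (rule machine_append_step[where d = Stay]) (simp_all add: machine_def)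
  have 3: "reaches ?M ?L (0 + 3, ?T (int (length ([] :: bool list))) ([3] @ [4]))
      (10 + 3, ?T (int ?L) ([3, 4] @ concat (map clause_symbols F)))"
    using machine_transduce[of "w F" "[]" "w F" 0 K p "[3, 4]"]
    by (simp add: w_def transduce_formula)
  have 4: "reaches ?M 1 (10 + 3, ?T (int ?L) ([3, 4] @ concat (map clause_symbols F)))
      (14, ?T (int ?L - 1) (([3, 4] @ concat (map clause_symbols F)) @ []))"
    by (rule machine_append_step[where d = Move_Left])
      (simp_all add: machine_def scanned_copy_tapes word_contents_def)
  have 5: "reaches ?M (Suc ?L) (14, ?T (int ?L - 1) ([3, 4] @ concat (map clause_symbols F)))
      (15, ?T (- 1) (formula_tape F))"
    using machine_pad[of ?L "w F" K p "[3, 4] @ concat (map clause_symbols F)"]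
    by (simp add: formula_tape_def w_def)
  have "reaches ?M 2 (0, ?T 0 []) (0 + 3, ?T (int (length ([] :: bool list))) ([3] @ [4]))"
    using 1 2 by (auto elim: reaches_trans)
  from reaches_trans[OF this 3 order_refl]
  have "reaches ?M (2 + ?L) (0, ?T 0 []) (10 + 3, ?T (int ?L) ([3, 4] @ concat (map clause_symbols F)))" .
  from reaches_trans[OF this 4 order_refl]
  have "reaches ?M (2 + ?L + 1) (0, ?T 0 []) (14, ?T (int ?L - 1) ([3, 4] @ concat (map clause_symbols F)))"
    by simp
  from reaches_trans[OF this 5, of "2 * ?L + 4"] show ?thesis by (simp add: init)
qed

text \<open>A literal with \<open>k\<close> digits takes \<open>k + 1\<close> symbols but
  \<open>2 * k + 2\<close> bits, which also makes room for the leading 5.\<close>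

lemma length_clause_symbols: "length (clause_symbols C) \<le> length (enc_clause C)"
proof -
  have "length (enc_list (\<lambda>b. [b]) bs) = Suc (2 * length bs)" for bs
    by (induction bs) (auto simp: enc_list_Nil enc_list_Cons)
  then have "length (literal_symbols l) < length (enc_literal l)" for l
    by (cases l) (simp add: enc_nat_def)
  from this[of "fst C"] this[of "fst (snd C)"] this[of "snd (snd C)"] show ?thesis
    by (cases C) simp
qed

lemma length_concat_clause_symbols:
  "length (concat (map clause_symbols F)) < length (enc_list enc_clause F)"
proof (induction F)
  case (Cons C F)
  then show ?case using length_clause_symbols[of C] by (simp add: enc_list_Cons)
qed (simp add: enc_list_Nil)

lemma set_formula_tape: "set (tl (formula_tape F)) \<subseteq> {4..10}"
proof -
  have "set (literal_symbols l) \<subseteq> {4..10}" for l by (cases l) auto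
  then have "set (clause_symbols C) \<subseteq> {4..10}" for C by (cases C) (simp del: literal_symbols.simps)
  then have "{4, 10} \<union> (\<Union>C \<in> set F. set (clause_symbols C)) \<subseteq> {4..10}"
    by (intro Un_least UN_least) simp_all
  moreover have "set (tl (formula_tape F)) \<subseteq> {4, 10} \<union> (\<Union>C \<in> set F. set (clause_symbols C))"
    by (simp add: formula_tape_def set_replicate_conv_if) blast
  ultimately show ?thesis by (rule subset_trans[rotated])
qed

lemma marked_tape_formula: "marked_tape (formula_tape F)"
proof
  fix i
  have t: "formula_tape F = 3 # tl (formula_tape F)" by (simp add: formula_tape_def)
  have *: "symbol_at (formula_tape F) (Suc j) \<in> {4..10}" if "Suc j < length (formula_tape F)" for j
  proof -
    have "tl (formula_tape F) ! j \<in> set (tl (formula_tape F))" using that by (intro nth_mem) simp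
    moreover have "symbol_at (formula_tape F) (Suc j) = tl (formula_tape F) ! j"
      using that by (simp add: symbol_at_def nth_tl)
    ultimately show ?thesis using set_formula_tape[of F] by (simp only:) blast
  qed
  have 0: "symbol_at (formula_tape F) 0 = 3" "0 < length (formula_tape F)"
    by (simp_all add: symbol_at_def formula_tape_def)
  have out: "symbol_at (formula_tape F) j = 0" if "length (formula_tape F) \<le> j" for j
    using that by (simp add: symbol_at_def)
  have "symbol_at (formula_tape F) i = 3 \<and> i = 0 \<or>
      symbol_at (formula_tape F) i \<in> {4..10} \<and> i \<noteq> 0 \<and> i < length (formula_tape F) \<or>
      symbol_at (formula_tape F) i = 0 \<and> length (formula_tape F) \<le> i"
  proof (cases "i = 0 \<or> length (formula_tape F) \<le> i")
    case False
    then obtain j where "i = Suc j" by (cases i) auto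
    with False *[of j] show ?thesis by simp
  qed (use 0 out in auto)
  then show "symbol_at (formula_tape F) i = 3 \<longleftrightarrow> i = 0"
    "symbol_at (formula_tape F) i = 0 \<longleftrightarrow> length (formula_tape F) \<le> i"
    using 0 by auto
qed

lemma program_computes:
  assumes wf: "wf_prog K p"
    and run: "\<And>F. snd (run (formula_tape F) p (\<lambda>_. length (formula_tape F), [])) = enc' (f F)"
  shows "poly_time_computable_on UNIV (enc_list enc_clause) enc' f"
proof -
  obtain P where P: "\<And>B. cost B p = poly P B" using cost_poly by blast
  \<comment> \<open>For input length \<open>L\<close> this is \<open>2 * L + 4\<close> steps of
    preparation plus the cost of the program on a tape of at most \<open>2 * L + 2\<close>
    symbols.\<close>
  define Q where "Q = [:4, 2:] + pcompose P [:2, 2:]"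
  have "tm_computes_within (machine K p) (enc_list enc_clause F) (enc' (f F))
      (poly Q (length (enc_list enc_clause F)))" for F
  proof -
    let ?w = "enc_list enc_clause F" and ?M = "machine K p" and ?tp = "formula_tape F"
    interpret marked_tape ?tp by (rule marked_tape_formula)
    have len: "length ?tp \<le> 2 * length ?w + 2"
      using length_concat_clause_symbols[of F] by (simp add: formula_tape_def)
    have imp: "implements K ?M p 15 1"
      by (simp add: implements_def machine_def)
    have rep: "represents K ?tp (\<lambda>_. length ?tp, []) (copy_tapes K ?w (- 1) ?tp)"
      by (simp add: represents_def copy_tapes_def nth_append)
    obtain ts where ts: "reaches ?M (cost (2 * length ?w + 2) p)
        (15, copy_tapes K ?w (- 1) ?tp) (1, ts)"
      "represents K ?tp (run ?tp p (\<lambda>_. length ?tp, [])) ts"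
      using simulation[OF imp _ wf rep _ len] by auto
    have "poly Q (length ?w) = 2 * length ?w + 4 + cost (2 * length ?w + 2) p"
      by (simp add: Q_def P poly_pcompose mult.commute)
    with reaches_trans[OF machine_prepare ts(1) order_refl]
    have "reaches ?M (poly Q (length ?w)) (tm_init ?M ?w) (1, ts)" by simp
    moreover have "fst (last ts) = word_contents (enc' (f F))"
    proof -
      have "length ts = Suc (Suc K)" and out: "fst (ts ! Suc K) = word_contents (enc' (f F))"
        using ts(2) run[of F] by (simp_all add: represents_def)
      then have "last ts = ts ! Suc K" by (subst last_conv_nth) auto
      with out show ?thesis by simp
    qed
    ultimately show ?thesis
      unfolding reaches_def tm_computes_within_def by blast
  qed
  with wf_machine[OF wf] show ?thesis unfolding poly_time_computable_on_def by blast
qed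

section \<open>Program constructs\<close>

text \<open>Register 9 is the scratch register of \<open>copy\<close>; registers 7, 8, 10 and 11 are scratch registers
  of the other macros. All of them are 0 between macros.\<close>

definition clear :: "nat \<Rightarrow> prog" where
  "clear r = Down r Skip"

text \<open>A head can be read only by moving it, so \<open>r\<close> is counted down into
  \<open>t\<close> and 9 together and then restored from 9.\<close>

definition copy :: "nat \<Rightarrow> nat \<Rightarrow> prog" where
  "copy r t = clear t ;; Down r (Inc t ;; Inc 9) ;; Down 9 (Inc r)"

text \<open>Register 8 receives the truncated difference \<open>b - a\<close>, which is 0, that is,
  on the left marker, iff \<open>a < b\<close> fails.\<close>

definition if_less :: "nat \<Rightarrow> nat \<Rightarrow> prog \<Rightarrow> prog \<Rightarrow> prog" where
  "if_less a b p q = copy b 8 ;; copy a 7 ;; Down 7 (Dec 8) ;; Branch 8 [3] q (clear 8 ;; p)"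

definition if_eq :: "nat \<Rightarrow> nat \<Rightarrow> prog \<Rightarrow> prog \<Rightarrow> prog" where
  "if_eq a b p q = if_less a b q (if_less b a q p)"

text \<open>The last clause symbol at or before the given position, with default 0 if there is
  none.\<close>

primrec clause_start :: "nat list \<Rightarrow> nat \<Rightarrow> nat" where
  "clause_start tp 0 = 0"
| "clause_start tp (Suc i) = (if symbol_at tp (Suc i) = 5 then Suc i else clause_start tp i)"

text \<open>The number of rounds is the starting position, which suffices because each round moves
  left until a clause symbol is found; later rounds do nothing.\<close>

definition find_clause :: "nat \<Rightarrow> nat \<Rightarrow> prog" where
  "find_clause a x = copy a x ;; copy a 7 ;; Down 7 (Branch x [5] Skip (Dec x))"

definition digits_at :: "nat list \<Rightarrow> nat \<Rightarrow> nat list" where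
  "digits_at tp i = takeWhile (\<lambda>s. s \<in> {8, 9}) (drop i tp)"

text \<open>The two heads advance together over equal digits and get stuck at the first difference
  or end, so surplus rounds are harmless.\<close>

definition match_digit :: prog where
  "match_digit = Branch 7 [8] (Branch 8 [8] (Inc 7 ;; Inc 8) Skip)
     (Branch 7 [9] (Branch 8 [9] (Inc 7 ;; Inc 8) Skip) Skip)"

text \<open>Register 17 holds the length of the tape.\<close>

definition if_same_name :: "nat \<Rightarrow> nat \<Rightarrow> prog \<Rightarrow> prog \<Rightarrow> prog" where
  "if_same_name a b p q = copy a 7 ;; Inc 7 ;; copy b 8 ;; Inc 8 ;; copy 17 10 ;;
     Down 10 match_digit ;;
     Branch 7 [8, 9] (clear 7 ;; clear 8 ;; q)
       (Branch 8 [8, 9] (clear 7 ;; clear 8 ;; q) (clear 7 ;; clear 8 ;; p))"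

text \<open>Register 0 holds the bound. Register \<open>l\<close> drives the loop downwards while
  the body sees \<open>i\<close> counting upwards from 0.\<close>

definition for_loop :: "nat \<Rightarrow> nat \<Rightarrow> prog \<Rightarrow> prog" where
  "for_loop i l p = copy 0 l ;; Down l (p ;; Inc i) ;; clear i"

definition emit_list :: "bool list \<Rightarrow> prog" where
  "emit_list bs = foldr (\<lambda>b p. Emit b ;; p) bs Skip"

text \<open>For the number \<open>a\<close> in register 1 this writes the low-order zeros in the code of \<open>2 ^ a\<close>.\<close>

definition emit_zeros :: prog where
  "emit_zeros = copy 1 7 ;; Down 7 (Emit True ;; Emit False)"

lemma wf_macros [simp]:
  "wf_prog K (clear r) \<longleftrightarrow> r < K"
  "r \<noteq> t \<Longrightarrow> r \<noteq> 9 \<Longrightarrow> wf_prog K (copy r t) \<longleftrightarrow> r < K \<and> t < K \<and> 9 < K"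
  "a \<notin> {7, 9} \<Longrightarrow> b \<notin> {8, 9} \<Longrightarrow> wf_prog K (if_less a b p q) \<longleftrightarrow>
     a < K \<and> b < K \<and> 9 < K \<and> wf_prog K p \<and> wf_prog K q"
  "a \<notin> {7, 8, 9} \<Longrightarrow> b \<notin> {7, 8, 9} \<Longrightarrow> wf_prog K (if_eq a b p q) \<longleftrightarrow>
     a < K \<and> b < K \<and> 9 < K \<and> wf_prog K p \<and> wf_prog K q"
  "x \<noteq> 7 \<Longrightarrow> a \<notin> {x, 7, 9} \<Longrightarrow> wf_prog K (find_clause a x) \<longleftrightarrow> a < K \<and> x < K \<and> 9 < K"
  "a \<notin> {7, 9} \<Longrightarrow> b \<notin> {8, 9} \<Longrightarrow> wf_prog K (if_same_name a b p q) \<longleftrightarrow>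
     a < K \<and> b < K \<and> 17 < K \<and> wf_prog K p \<and> wf_prog K q"
  "0 < l \<Longrightarrow> l \<noteq> i \<Longrightarrow> l \<notin> mods p \<Longrightarrow> wf_prog K (for_loop i l p) \<longleftrightarrow>
     i < K \<and> l < K \<and> 9 < K \<and> wf_prog K p"
  "wf_prog K (emit_list bs)"
  "wf_prog K emit_zeros \<longleftrightarrow> 9 < K"
         apply (auto simp: clear_def copy_def)[2]
       apply (auto simp: if_less_def clear_def copy_def)[1]
      apply (auto simp: if_eq_def if_less_def clear_def copy_def)[1]
     apply (auto simp: find_clause_def clear_def copy_def)[1]
    apply (auto simp: if_same_name_def match_digit_def clear_def copy_def)[1]
   apply (auto simp: for_loop_def clear_def copy_def)[1]
  by (induction bs) (auto simp: emit_list_def emit_zeros_def clear_def copy_def)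

lemma mods_emit_list: "mods (emit_list bs) = {}"
  by (induction bs) (auto simp: emit_list_def)

lemma mods_macros [simp]:
  "mods (clear r) = {r}"
  "mods (copy r t) = {r, t, 9}"
  "mods (if_less a b p q) = {a, b, 7, 8, 9} \<union> mods p \<union> mods q"
  "mods (if_eq a b p q) = {a, b, 7, 8, 9} \<union> mods p \<union> mods q"
  "mods (find_clause a x) = {a, x, 7, 9}"
  "mods (if_same_name a b p q) = {a, b, 7, 8, 9, 10, 17} \<union> mods p \<union> mods q"
  "mods (for_loop i l p) = {0, i, l, 9} \<union> mods p"
  "mods (emit_list bs) = {}"
  "mods emit_zeros = {1, 7, 9}"
  by (auto simp: clear_def copy_def if_less_def if_eq_def find_clause_def match_digit_def
      if_same_name_def for_loop_def emit_zeros_def mods_emit_list)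

section \<open>A rule for loops and the correctness of the constructs\<close>

lemma run_emit_list: "run tp (emit_list bs) (h, out) = (h, out @ bs)"
  by (induction bs arbitrary: out) (auto simp: emit_list_def)

text \<open>A loop rule: \<open>g i\<close> and \<open>b i\<close> are the invariant store and
  output with \<open>i\<close> rounds left, where the loop register itself is overwritten by
  \<open>i\<close>.\<close>

lemma run_Down:
  assumes "\<And>i. i < k \<Longrightarrow> run tp p ((g (Suc i))(r := i), b (Suc i)) = ((g i)(r := i), b i)"
    and "h = (g k)(r := k)" "out = b k"
  shows "run tp (Down r p) (h, out) = ((g 0)(r := 0), b 0)"
proof -
  let ?f = "\<lambda>(h, out). run tp p (h(r := h r - 1), out)"
  have "(?f ^^ j) ((g (i + j))(r := i + j), b (i + j)) = ((g i)(r := i), b i)" if "i + j \<le> k" for i j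
    using that
  proof (induction j)
    case (Suc j)
    have "?f ((g (Suc (i + j)))(r := Suc (i + j)), b (Suc (i + j)))
        = ((g (i + j))(r := i + j), b (i + j))"
      using assms(1)[of "i + j"] Suc.prems by simp
    then show ?case using Suc
      by (simp only: add_Suc_right funpow_Suc_right comp_apply)
  qed simp
  from this[of 0 k] show ?thesis by (simp add: assms(2,3))
qed

lemma run_clear: "run tp (clear r) (h, out) = (h(r := 0), out)"
  unfolding clear_def by (subst run_Down[where g = "\<lambda>_. h" and b = "\<lambda>_. out" and k = "h r"]) auto

context marked_tape
begin

lemma run_copy:
  assumes "r \<noteq> t" "r \<noteq> 9" "t \<noteq> 9" "h 9 = 0" "h r \<le> length tp"
  shows "run tp (copy r t) (h, out) = (h(t := h r), out)"
proof -
  let ?v = "h r"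
  have 1: "run tp (Down r (Inc t ;; Inc 9)) (h(t := 0), out)
      = ((h(t := ?v - 0, 9 := ?v - 0))(r := 0), out)"
    by (rule run_Down[where g = "\<lambda>i. h(t := ?v - i, 9 := ?v - i)" and b = "\<lambda>_. out" and k = "?v"])
      (use assms in \<open>auto simp: fun_eq_iff symbol_at_0_iff\<close>)
  have 2: "run tp (Down 9 (Inc r)) (h(t := ?v, 9 := ?v, r := 0), out)
      = ((h(t := ?v, r := ?v - 0))(9 := 0), out)"
    by (rule run_Down[where g = "\<lambda>i. h(t := ?v, r := ?v - i)" and b = "\<lambda>_. out" and k = "?v"])
      (use assms in \<open>auto simp: fun_eq_iff symbol_at_0_iff\<close>)
  have "h(t := ?v, r := ?v, 9 := 0) = h(t := ?v)" using assms by auto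
  with 1 2 show ?thesis by (simp add: copy_def run_clear)
qed

lemma run_if_less:
  assumes "a \<notin> {7, 8, 9}" "b \<notin> {7, 8, 9}" "h 7 = 0" "h 8 = 0" "h 9 = 0"
    and "h a \<le> length tp" "h b \<le> length tp"
  shows "run tp (if_less a b p q) (h, out) = run tp (if h a < h b then p else q) (h, out)"
proof -
  have 1: "run tp (Down 7 (Dec 8)) (h(8 := h b, 7 := h a), out)
      = ((h(8 := h b - (h a - 0)))(7 := 0), out)"
    by (rule run_Down[where g = "\<lambda>i. h(8 := h b - (h a - i))" and b = "\<lambda>_. out" and k = "h a"])
      (use assms in \<open>auto simp: fun_eq_iff\<close>)
  have 2: "h(8 := 0, 7 := 0) = h" "h(8 := h b - h a, 7 := 0, 8 := 0) = h" using assms by auto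
  show ?thesis
    using assms 1 2 by (auto simp: if_less_def run_copy run_clear symbol_at_3_iff)
qed

lemma run_if_eq:
  assumes "a \<notin> {7, 8, 9}" "b \<notin> {7, 8, 9}" "h 7 = 0" "h 8 = 0" "h 9 = 0"
    and "h a \<le> length tp" "h b \<le> length tp"
  shows "run tp (if_eq a b p q) (h, out) = run tp (if h a = h b then p else q) (h, out)"
  using assms by (auto simp: if_eq_def run_if_less)

lemma run_find_clause:
  assumes "a \<notin> {7, 9}" "x \<notin> {7, 9}" "a \<noteq> x" "h 7 = 0" "h 9 = 0" "h a \<le> length tp"
  shows "run tp (find_clause a x) (h, out) = (h(x := clause_start tp (h a)), out)"
proof -
  define f where "f y = (if symbol_at tp y = 5 then y else y - 1)" for y
  define v where "v i = (f ^^ (h a - i)) (h a)" for i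
  have v_step: "v i = f (v (Suc i))" if "i < h a" for i
  proof -
    have "h a - i = Suc (h a - Suc i)" using that by simp
    then show ?thesis by (simp add: v_def)
  qed
  have 1: "run tp (Down 7 (Branch x [5] Skip (Dec x))) (h(x := h a, 7 := h a), out)
      = ((h(x := v 0))(7 := 0), out)"
    by (rule run_Down[where g = "\<lambda>i. h(x := v i)" and b = "\<lambda>_. out" and k = "h a"])
      (use assms v_step in \<open>auto simp: fun_eq_iff f_def v_def\<close>)
  have start: "clause_start tp y = y" if "symbol_at tp y = 5" for y
    using that by (cases y) auto
  \<comment> \<open>One round preserves \<open>clause_start\<close>, since it moves left only from a
    position without a clause symbol.\<close>
  have "clause_start tp (f y) = clause_start tp y" for y
    by (cases y) (auto simp: f_def)
  then have inv: "clause_start tp ((f ^^ k) y) = clause_start tp y" for k y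
    by (induction k) auto
  \<comment> \<open>After \<open>h a\<close> rounds the head is at 0 or on a clause symbol, and both
    are fixed points of \<open>clause_start\<close>.\<close>
  have "(f ^^ k) (h a) \<le> h a - k \<or> symbol_at tp ((f ^^ k) (h a)) = 5" for k
    by (induction k) (auto simp: f_def)
  from this[of "h a"] have "v 0 = 0 \<or> symbol_at tp (v 0) = 5" by (auto simp: v_def)
  then have "clause_start tp (v 0) = v 0" using start by auto
  then have v0: "v 0 = clause_start tp (h a)" using inv by (simp add: v_def)
  have 2: "h(x := y, 7 := 0) = h(x := y)" for y using assms by auto
  show ?thesis
    using assms 1 unfolding v0 2 by (simp add: find_clause_def run_copy)
qed

lemma digits_at_rec:
  "digits_at tp i = (if symbol_at tp i \<in> {8, 9} then symbol_at tp i # digits_at tp (Suc i) else [])"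
proof (cases "i < length tp")
  case True
  then have "drop i tp = tp ! i # drop (Suc i) tp" by (rule Cons_nth_drop_Suc[symmetric])
  with True show ?thesis by (simp add: digits_at_def symbol_at_def)
qed (simp add: digits_at_def symbol_at_def)

lemma run_if_same_name:
  assumes "a \<notin> {7, 8, 9, 10, 17}" "b \<notin> {7, 8, 9, 10, 17}"
    and "h 7 = 0" "h 8 = 0" "h 9 = 0" "h 10 = 0" "h 17 = length tp"
    and "h a < length tp" "h b < length tp"
  shows "run tp (if_same_name a b p q) (h, out) =
    run tp (if digits_at tp (Suc (h a)) = digits_at tp (Suc (h b)) then p else q) (h, out)"
proof -
  let ?s = "symbol_at tp" and ?d = "digits_at tp"
  define f where "f = (\<lambda>(u, v). if ?s u = ?s v \<and> ?s u \<in> {8, 9} then (Suc u, Suc v) else (u, v))"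
  have step: "run tp match_digit (h', out) = (h'(7 := fst (f (h' 7, h' 8)), 8 := snd (f (h' 7, h' 8))), out)"
    for h' using fun_upd_triv[of h'] by (auto simp: match_digit_def f_def)
  let ?e = "length tp" and ?uv = "(Suc (h a), Suc (h b))"
  define w where "w i = (f ^^ (?e - i)) ?uv" for i
  have w_step: "w i = f (w (Suc i))" if "i < ?e" for i
  proof -
    have "?e - i = Suc (?e - Suc i)" using that by simp
    then show ?thesis by (simp add: w_def)
  qed
  have 1: "run tp (Down 10 match_digit) (h(7 := Suc (h a), 8 := Suc (h b), 10 := ?e), out)
      = ((h(7 := fst (w 0), 8 := snd (w 0)))(10 := 0), out)"
  proof (rule run_Down[where g = "\<lambda>i. h(7 := fst (w i), 8 := snd (w i))" and b = "\<lambda>_. out"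
        and k = "?e"])
    fix i assume "i < ?e"
    then show "run tp match_digit ((h(7 := fst (w (Suc i)), 8 := snd (w (Suc i))))(10 := i), out)
        = ((h(7 := fst (w i), 8 := snd (w i)))(10 := i), out)"
      unfolding step w_step[OF \<open>i < ?e\<close>] by (simp add: fun_eq_iff)
  qed (auto simp: fun_eq_iff w_def)
  \<comment> \<open>The heads drop equal digits simultaneously, so equality of the remaining digit
    strings is an invariant.\<close>
  define same where "same = (\<lambda>(u, v). ?d u = ?d v)"
  have "same (f (u, v)) = same (u, v)" for u v
    using digits_at_rec[of u] digits_at_rec[of v] by (simp add: same_def f_def)
  then have "same (f x) = same x" for x
    by (cases x) simp
  then have inv: "same ((f ^^ k) x) = same x" for k x
    by (induction k) auto
  \<comment> \<open>Every round that moves the heads consumes a digit of the first string, so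
    \<open>length tp\<close> rounds end in a fixed point.\<close>
  have fixed: "f ((f ^^ k) x) = (f ^^ k) x \<or> length (?d (fst ((f ^^ k) x))) + k \<le> length (?d (fst x))"
    for k x
  proof (induction k)
    case (Suc k)
    obtain u v where uv: "(f ^^ k) x = (u, v)" by force
    show ?case
    proof (cases "f (u, v) = (u, v)")
      case True
      with uv show ?thesis by simp
    next
      case False
      then have "f (u, v) = (Suc u, Suc v)" "?s u \<in> {8, 9}" by (auto simp: f_def split: if_splits)
      with Suc uv False digits_at_rec[of u] show ?thesis by simp
    qed
  qed simp
  obtain u v where uv: "w 0 = (u, v)" by force
  have "length (?d (Suc (h a))) \<le> ?e"
    unfolding digits_at_def using length_takeWhile_le[of _ "drop (Suc (h a)) tp"]
    by (rule order_trans) simp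
  moreover have "f (u, v) = (u, v) \<or> length (?d u) + ?e \<le> length (?d (Suc (h a)))"
    using fixed[of ?e ?uv] uv by (simp add: w_def)
  ultimately have "f (u, v) = (u, v) \<or> length (?d u) = 0" by linarith
  then have "f (u, v) = (u, v) \<or> ?d u = []" by simp
  then have "f (u, v) = (u, v)" using digits_at_rec[of u] by (auto simp: f_def split: if_splits)
  then have "\<not> (?s u = ?s v \<and> ?s u \<in> {8, 9})" by (auto simp: f_def split: if_splits)
  \<comment> \<open>At a fixed point the strings do not begin with a common digit, so they agree
    only if both are empty.\<close>
  then have "?d u = ?d v \<longleftrightarrow> ?s u \<notin> {8, 9} \<and> ?s v \<notin> {8, 9}"
    using digits_at_rec[of u] digits_at_rec[of v] by (auto split: if_splits)
  then have eq: "?d (Suc (h a)) = ?d (Suc (h b)) \<longleftrightarrow> ?s u \<notin> {8, 9} \<and> ?s v \<notin> {8, 9}"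
    using inv[of ?e ?uv] uv by (simp add: same_def w_def)
  have "h(7 := u, 8 := v, 10 := 0, 7 := 0, 8 := 0) = h" using assms by auto
  moreover have "(h(7 := Suc (h a), 8 := Suc (h b))) 17 = ?e" using assms by simp
  ultimately show ?thesis
    using assms 1 eq uv by (simp add: if_same_name_def run_copy run_clear symbol_at_0_iff not_le)
qed

lemma run_for:
  assumes "i \<notin> {0, l, 9}" "l \<notin> {0, 9}" "h i = 0" "h l = 0" "h 9 = 0" "h 0 = n" "n \<le> length tp"
    and body: "\<And>j m out. j < n \<Longrightarrow>
      run tp p (h(l := m, i := j), out) = (h(l := m, i := j), out @ f j)"
  shows "run tp (for_loop i l p) (h, out) = (h, out @ concat (map f [0..<n]))"
proof -
  have 1: "run tp (Down l (p ;; Inc i)) (h(l := n), out)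
    = ((h(i := n - 0))(l := 0), out @ concat (map f [0..<n - 0]))"
  proof (rule run_Down[where g = "\<lambda>m. h(i := n - m)" and b = "\<lambda>m. out @ concat (map f [0..<n - m])"
        and k = n])
    fix m assume m: "m < n"
    then have n: "n - m = Suc (n - Suc m)" and below: "\<not> length tp \<le> n - Suc m"
      using assms(7) by simp_all
    have "(h(i := n - Suc m))(l := m) = h(l := m, i := n - Suc m)" using assms(1) by auto
    moreover have "h(l := m, i := n - m) = h(i := n - m, l := m)" using assms(1) by auto
    ultimately show "run tp (p ;; Inc i) ((h(i := n - Suc m))(l := m), out @ concat (map f [0..<n - Suc m]))
        = ((h(i := n - m))(l := m), out @ concat (map f [0..<n - m]))"
      using m assms(7) by (simp add: body symbol_at_0_iff n below)
  qed (use assms in auto)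
  have "h(i := n, l := 0, i := 0) = h" using assms by auto
  with 1 assms show ?thesis by (simp add: for_loop_def run_copy run_clear)
qed

lemma run_emit_zeros:
  assumes "h 7 = 0" "h 9 = 0" "h 1 \<le> length tp"
  shows "run tp emit_zeros (h, out) = (h, out @ concat (replicate (h 1) [True, False]))"
proof -
  let ?z = "\<lambda>k. concat (replicate k [True, False])"
  have z: "?z (Suc k) = ?z k @ [True, False]" for k
    using replicate_append_same[of k "[True, False]"] by (metis concat.simps concat_append append_Nil2 replicate_Suc)
  have "run tp (Down 7 (Emit True ;; Emit False)) (h(7 := h 1), out)
      = (h(7 := 0), out @ ?z (h 1 - 0))"
    by (rule run_Down[where g = "\<lambda>_. h" and b = "\<lambda>i. out @ ?z (h 1 - i)" and k = "h 1"])
      (auto simp: Suc_diff_Suc[symmetric] z simp del: concat.simps replicate.simps)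
  moreover have "h(7 := 0) = h" using assms by auto
  ultimately show ?thesis using assms by (simp add: emit_zeros_def run_copy)
qed

end

section \<open>The program computing the reduction\<close>

text \<open>On the diagonal, a position that is neither 0 nor the start of a literal conflicts with
  itself; for parallel \<open>x\<close> and \<open>y\<close> this forces that coordinate to
  vanish.\<close>

definition conflict :: "nat list \<Rightarrow> nat \<Rightarrow> nat \<Rightarrow> bool" where
  "conflict tp p q \<longleftrightarrow>
     (if p = q then symbol_at tp p \<notin> {3, 6, 7}
      else symbol_at tp p \<in> {6, 7} \<and> symbol_at tp q \<in> {6, 7} \<and>
        (clause_start tp p = clause_start tp q \<or>
         symbol_at tp p \<noteq> symbol_at tp q \<and> digits_at tp (Suc p) = digits_at tp (Suc q)))"

text \<open>Matrices are indexed by \<open>p, q\<close> and by a third index, which only repeats them; \<open>r\<close> is the row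
  and \<open>c\<close> the column of an entry, which still has to be divided by \<open>4 n\<close>.\<close>

definition conflict_entry :: "nat list \<Rightarrow> nat \<Rightarrow> nat \<Rightarrow> nat \<Rightarrow> nat \<Rightarrow> int" where
  "conflict_entry tp p q r c =
     (if c = q \<and> (if conflict tp p q then r = p else symbol_at tp r = 4) then 2 else 0)"

definition parallel_entry :: "nat list \<Rightarrow> nat \<Rightarrow> nat \<Rightarrow> nat \<Rightarrow> nat \<Rightarrow> int" where
  "parallel_entry tp p q r c =
     (if p = q then (if c = p \<and> symbol_at tp r = 4 then 2 else 0)
      else if p < q then (if r = p \<and> c = q then 2 else if r = q \<and> c = p then - 2 else 0)
      else 0)"

definition clause_entry :: "nat list \<Rightarrow> nat \<Rightarrow> nat \<Rightarrow> nat \<Rightarrow> nat \<Rightarrow> int" where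
  "clause_entry tp p q r c =
     (if c \<noteq> q then 0
      else if symbol_at tp p = 5 then
        (if symbol_at tp r = 3 then - 1
         else if symbol_at tp r \<in> {6, 7} \<and> clause_start tp r = p then 1 else 0)
      else if symbol_at tp r = 4 then 2 else 0)"

definition scaled_code :: "nat \<Rightarrow> int \<Rightarrow> bool list" where
  "scaled_code a e = enc_complex (complex_of_int e / complex_of_nat (4 * 2 ^ a))"

text \<open>In lowest terms \<open>2 / (4 * n)\<close> is \<open>1 / 2 ^ (a + 1)\<close> and
  \<open>1 / (4 * n)\<close> is \<open>1 / 2 ^ (a + 2)\<close>. So for a nonzero entry the numerator
  is 1 up to sign, one or two zeros follow those of \<open>emit_zeros\<close>, and the last five
  bits encode the imaginary part 0.\<close>

definition emit_scaled :: "int \<Rightarrow> prog" where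
  "emit_scaled e =
     (if e = 0 then emit_list [False, False, True, True, False, False, False, True, True, False]
      else emit_list [e < 0, True, True, False] ;; emit_zeros ;;
        emit_list ((if even e then [True, False] else [True, False, True, False]) @
          [True, True, False, False, False, True, True, False]))"

text \<open>Registers 3, 4, 5, 6 hold \<open>p, q, r, c\<close>.\<close>

definition if_conflict :: "prog \<Rightarrow> prog \<Rightarrow> prog" where
  "if_conflict P Q =
     if_eq 3 4 (Branch 3 [3, 6, 7] Q P)
       (Branch 3 [6, 7]
         (Branch 4 [6, 7]
           (find_clause 3 10 ;; find_clause 4 11 ;;
            if_eq 10 11 (clear 10 ;; clear 11 ;; P)
              (clear 10 ;; clear 11 ;;
               Branch 3 [6]
                 (Branch 4 [7] (if_same_name 3 4 P Q) Q)
                 (Branch 4 [6] (if_same_name 3 4 P Q) Q)))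
           Q)
         Q)"

definition conflict_prog :: prog where
  "conflict_prog =
     if_eq 6 4
       (if_conflict
         (if_eq 5 3 (emit_scaled 2) (emit_scaled 0))
         (Branch 5 [4] (emit_scaled 2) (emit_scaled 0)))
       (emit_scaled 0)"

definition parallel_prog :: prog where
  "parallel_prog =
     if_eq 3 4
       (if_eq 6 3 (Branch 5 [4] (emit_scaled 2) (emit_scaled 0)) (emit_scaled 0))
       (if_less 3 4
         (if_eq 5 3
           (if_eq 6 4 (emit_scaled 2) (emit_scaled 0))
           (if_eq 5 4 (if_eq 6 3 (emit_scaled (- 2)) (emit_scaled 0)) (emit_scaled 0)))
         (emit_scaled 0))"

definition clause_prog :: prog where
  "clause_prog =
     if_eq 6 4
       (Branch 3 [5]
         (Branch 5 [3] (emit_scaled (- 1))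
           (Branch 5 [6, 7]
             (find_clause 5 10 ;;
              if_eq 10 3 (clear 10 ;; emit_scaled 1) (clear 10 ;; emit_scaled 0))
             (emit_scaled 0)))
         (Branch 5 [4] (emit_scaled 2) (emit_scaled 0)))
       (emit_scaled 0)"

text \<open>The emitted \<open>True\<close> announces a matrix, row or entry, and
  \<open>False\<close> closes a row or a matrix; the outer list stays open because several such
  blocks follow each other. Register 2 holds the repeating index, and 12 to 16 drive the
  loops.\<close>

definition matrix_loop :: "prog \<Rightarrow> prog" where
  "matrix_loop P =
     for_loop 2 12 (for_loop 3 13 (for_loop 4 14 (Emit True ;;
       for_loop 5 15 (Emit True ;; for_loop 6 16 (Emit True ;; P) ;; Emit False) ;; Emit False)))"

text \<open>Register 7 saturates at \<open>length tp\<close>, so a blank under its head means that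
  the doubled value is not below the tape length. Then registers 0 and 1 are kept.\<close>

definition double_step :: prog where
  "double_step = copy 0 7 ;; copy 0 8 ;; Down 8 (Inc 7) ;;
     Branch 7 [0] (clear 7) (copy 7 0 ;; clear 7 ;; Inc 1)"

text \<open>All heads start at \<open>length tp\<close>, and register 17 keeps this value. Register
  0 is doubled from 1 on, while register 1 counts the doublings.\<close>

definition setup_prog :: prog where
  "setup_prog = foldr (\<lambda>r p. clear r ;; p) [0..<17] Skip ;; Inc 0 ;;
     copy 17 10 ;; Down 10 double_step"

text \<open>The second number is \<open>4 * n ^ 3\<close>, that is \<open>2 ^ (3 * a + 2)\<close>:
  three runs of \<open>a\<close> zeros and two more. The final \<open>False\<close> closes the list
  filled by the four loops.\<close>

definition reduction_prog :: prog where
  "reduction_prog = setup_prog ;;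
     emit_zeros ;; emit_list [True, True, False] ;;
     emit_zeros ;; emit_zeros ;; emit_zeros ;; emit_list [True, False, True, False, True, True, False] ;;
     matrix_loop conflict_prog ;; matrix_loop conflict_prog ;;
     matrix_loop parallel_prog ;; matrix_loop clause_prog ;; Emit False"

lemma emit_scaled_static: "wf_prog K (emit_scaled e) \<longleftrightarrow> e = 0 \<or> 9 < K" "mods (emit_scaled e) \<subseteq> {1, 7, 9}"
  by (auto simp: emit_scaled_def)

lemma if_conflict_static:
  "wf_prog 18 P \<Longrightarrow> wf_prog 18 Q \<Longrightarrow> wf_prog 18 (if_conflict P Q)"
  "mods (if_conflict P Q) \<subseteq> {3, 4, 7, 8, 9, 10, 11, 17} \<union> mods P \<union> mods Q"
  by (auto simp: if_conflict_def)

text \<open>The bound on \<open>mods\<close> keeps registers 12 to 16, the counters of the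
  surrounding loops, untouched.\<close>

lemma conflict_prog_static:
  "wf_prog 18 conflict_prog" "mods conflict_prog \<subseteq> {..11} \<union> {17}"
proof -
  show "wf_prog 18 conflict_prog"
    by (simp add: conflict_prog_def emit_scaled_static if_conflict_static)
  show "mods conflict_prog \<subseteq> {..11} \<union> {17}"
    using emit_scaled_static(2)[of 2] emit_scaled_static(2)[of 0]
      if_conflict_static(2)[of "if_eq 5 3 (emit_scaled 2) (emit_scaled 0)"
        "Branch 5 [4] (emit_scaled 2) (emit_scaled 0)"]
    by (fastforce simp: conflict_prog_def)
qed

lemma parallel_prog_static:
  "wf_prog 18 parallel_prog" "mods parallel_prog \<subseteq> {..11} \<union> {17}"
proof -
  show "wf_prog 18 parallel_prog"
    by (simp add: parallel_prog_def emit_scaled_static)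
  show "mods parallel_prog \<subseteq> {..11} \<union> {17}"
    using emit_scaled_static(2)[of 2] emit_scaled_static(2)[of 0] emit_scaled_static(2)[of "- 2"]
    by (fastforce simp: parallel_prog_def)
qed

lemma clause_prog_static:
  "wf_prog 18 clause_prog" "mods clause_prog \<subseteq> {..11} \<union> {17}"
proof -
  show "wf_prog 18 clause_prog"
    by (simp add: clause_prog_def emit_scaled_static)
  show "mods clause_prog \<subseteq> {..11} \<union> {17}"
    using emit_scaled_static(2)[of 2] emit_scaled_static(2)[of 0] emit_scaled_static(2)[of "- 1"]
      emit_scaled_static(2)[of 1]
    by (fastforce simp: clause_prog_def)
qed

lemma wf_matrix_loop:
  assumes "wf_prog 18 P" "mods P \<subseteq> {..11} \<union> {17}"
  shows "wf_prog 18 (matrix_loop P)"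
proof -
  have "12 \<notin> mods P" "13 \<notin> mods P" "14 \<notin> mods P" "15 \<notin> mods P" "16 \<notin> mods P"
    using assms(2) by auto
  with assms(1) show ?thesis by (simp add: matrix_loop_def)
qed

lemma wf_reduction_prog: "wf_prog 18 reduction_prog"
proof -
  have "wf_prog 18 setup_prog"
    by (simp add: setup_prog_def double_step_def upt_rec[of _ "17"])
  with conflict_prog_static parallel_prog_static clause_prog_static show ?thesis
    by (simp add: reduction_prog_def wf_matrix_loop)
qed

section \<open>Bit codes of powers of two and of scaled entries\<close>

lemma binary_digits_power: "binary_digits (2 ^ k) = replicate k False @ [True]"
proof (induction k)
  case 0
  show ?case using binary_digits.simps[of 1] binary_digits.simps[of 0] by simp
next
  case (Suc k)
  then show ?case by (subst binary_digits.simps) simp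
qed

lemma enc_nat_power: "enc_nat (2 ^ k) = concat (replicate k [True, False]) @ [True, True, False]"
proof -
  have "enc_list (\<lambda>b. [b]) (replicate k False @ [True]) =
      concat (replicate k [True, False]) @ [True, True, False]"
    by (induction k) (simp_all add: enc_list_Cons enc_list_Nil)
  then show ?thesis by (simp add: enc_nat_def binary_digits_power)
qed

lemma enc_nat_0: "enc_nat 0 = [False]" and enc_nat_1: "enc_nat 1 = [True, True, False]"
  using enc_nat_power[of 0] by (simp_all add: enc_nat_def binary_digits.simps[of 0] enc_list_Nil)

lemma enc_complex_of_rat: "enc_complex (complex_of_real (of_rat x)) = enc_rat x @ enc_rat 0"
proof -
  have inv: "the_inv real_of_rat (real_of_rat q) = q" for q
    by (rule the_inv_f_f) (auto intro: injI)
  show ?thesis using inv[of x] inv[of 0] by (simp add: enc_complex_def)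
qed

lemma enc_rat_0: "enc_rat 0 = [False, False, True, True, False]"
  using enc_nat_0 enc_nat_1 by (simp add: enc_rat_def enc_int_def)

lemma scaled_code_0:
  "scaled_code a 0 = [False, False, True, True, False, False, False, True, True, False]"
  using enc_complex_of_rat[of 0] by (simp add: scaled_code_def enc_rat_0)

lemma enc_complex_unit_fraction:
  assumes "\<bar>s\<bar> = 1"
  shows "enc_complex (complex_of_int s / complex_of_nat (2 ^ k)) =
    (s < 0) # enc_nat 1 @ enc_nat (2 ^ k) @ [False, False, True, True, False]"
proof -
  have "complex_of_int s / complex_of_nat (2 ^ k) = complex_of_real (of_rat (Rat.Fract s (2 ^ k)))"
    by (simp add: of_rat_rat)
  moreover have "coprime s (2 ^ k)" using assms by (intro is_unit_left_imp_coprime) simp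
  then have "quotient_of (Rat.Fract s (2 ^ k)) = (s, 2 ^ k)"
    by (simp add: quotient_of_Fract Rat.normalize_stable)
  then have "enc_rat (Rat.Fract s (2 ^ k)) = (s < 0) # enc_nat 1 @ enc_nat (2 ^ k)"
    using assms by (simp add: enc_rat_def enc_int_def nat_power_eq)
  ultimately show ?thesis by (simp only: enc_complex_of_rat enc_rat_0) simp
qed

lemma scaled_code_eq:
  assumes "e \<in> {1, - 1, 2, - 2}"
  shows "scaled_code a e = [e < 0, True, True, False] @ concat (replicate a [True, False]) @
    (if even e then [True, False] else [True, False, True, False]) @
    [True, True, False, False, False, True, True, False]"
proof -
  have z: "concat (replicate (Suc k) [True, False]) = concat (replicate k [True, False]) @ [True, False]" for k
    using replicate_append_same[of k "[True, False]"]
    by (metis append_Nil2 concat.simps concat_append replicate_Suc)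
  have "complex_of_int e / complex_of_nat (4 * 2 ^ a) =
      complex_of_int (sgn e) / complex_of_nat (2 ^ (if even e then Suc a else Suc (Suc a)))"
    using assms by auto
  moreover have "\<bar>sgn e\<bar> = 1" "(sgn e < 0) = (e < 0)" using assms by auto
  ultimately show ?thesis
    by (simp only: scaled_code_def enc_complex_unit_fraction enc_nat_1 enc_nat_power split: if_split)
      (simp add: z del: replicate.simps)
qed

definition matrix_code :: "nat \<Rightarrow> nat \<Rightarrow> (nat \<Rightarrow> nat \<Rightarrow> int) \<Rightarrow> bool list" where
  "matrix_code n a e =
     enc_list (enc_list (scaled_code a)) (map (\<lambda>r. map (\<lambda>c. e r c) [0..<n]) [0..<n])"

definition matrices_code ::
  "nat \<Rightarrow> nat \<Rightarrow> (nat \<Rightarrow> nat \<Rightarrow> nat \<Rightarrow> nat \<Rightarrow> int) \<Rightarrow> bool list" where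
  "matrices_code n a e = concat (map (\<lambda>k. concat (map (\<lambda>p. concat (map (\<lambda>q.
     True # matrix_code n a (e p q)) [0..<n])) [0..<n])) [0..<n])"

text \<open>On tapes of length at least 2, \<open>2 ^ exponent tp\<close> is the largest power of
  two strictly below the length, and it is at least half of the length.\<close>

definition exponent :: "nat list \<Rightarrow> nat" where
  "exponent tp = (LEAST a. length tp \<le> 2 * 2 ^ a)"

section \<open>Correctness of the reduction program\<close>

context marked_tape
begin

text \<open>The condition under which the macros are exact: empty scratch registers, and heads that
  copying does not push against the right end.\<close>

definition ready :: "store \<Rightarrow> bool" where
  "ready h \<longleftrightarrow> h 7 = 0 \<and> h 8 = 0 \<and> h 9 = 0 \<and> h 10 = 0 \<and> h 11 = 0 \<and> h 17 = length tp \<and>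
     (\<forall>r \<in> {0, 1, 3, 4, 5, 6}. h r \<le> length tp)"

lemma run_emit_scaled:
  assumes "ready h" "e \<in> {0, 1, - 1, 2, - 2}"
  shows "run tp (emit_scaled e) (h, out) = (h, out @ scaled_code (h 1) e)"
proof (cases "e = 0")
  case True
  then show ?thesis by (simp add: emit_scaled_def run_emit_list scaled_code_0)
next
  case False
  with assms(2) have "e \<in> {1, - 1, 2, - 2}" by blast
  from scaled_code_eq[OF this] False assms(1) show ?thesis
    by (simp add: emit_scaled_def run_emit_list run_emit_zeros ready_def)
qed

lemma clause_start_le: "clause_start tp i \<le> i"
  by (induction i) auto

lemma run_if_conflict:
  assumes "ready h"
  shows "run tp (if_conflict P Q) (h, out) = run tp (if conflict tp (h 3) (h 4) then P else Q) (h, out)"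
proof -
  \<comment> \<open>\<open>if_same_name\<close> moves one position past the sign, which requires the
    sign to lie strictly inside the tape.\<close>
  have below: "h r < length tp" if "symbol_at tp (h r) \<in> {6, 7}" for r
    using that symbol_at_0_iff[of "h r"] by (cases "h r < length tp") auto
  have reset: "h(10 := 0, 11 := 0) = h"
    using assms by (auto simp: ready_def)
  have le: "clause_start tp (h 3) \<le> length tp" "clause_start tp (h 4) \<le> length tp"
    using assms clause_start_le[of "h 3"] clause_start_le[of "h 4"] by (auto simp: ready_def)
  have find: "run tp (find_clause 3 10 ;; find_clause 4 11 ;;
        if_eq 10 11 (clear 10 ;; clear 11 ;; P') (clear 10 ;; clear 11 ;; Q')) (h, out)
      = run tp (if clause_start tp (h 3) = clause_start tp (h 4) then P' else Q') (h, out)" for P' Q'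
    using assms le by (simp add: ready_def run_find_clause run_if_eq run_clear reset)
  have "run tp (if_same_name 3 4 P Q) (h, out) =
      run tp (if digits_at tp (Suc (h 3)) = digits_at tp (Suc (h 4)) then P else Q) (h, out)"
    if "symbol_at tp (h 3) \<in> {6, 7}" "symbol_at tp (h 4) \<in> {6, 7}"
    using assms below[OF that(1)] below[OF that(2)] by (intro run_if_same_name) (auto simp: ready_def)
  with assms show ?thesis
    by (simp add: if_conflict_def run_if_eq ready_def find[unfolded run.simps(5)] conflict_def)
qed

lemma run_conflict_prog:
  assumes "ready h"
  shows "run tp conflict_prog (h, out) =
    (h, out @ scaled_code (h 1) (conflict_entry tp (h 3) (h 4) (h 5) (h 6)))"
  using assms
  by (simp add: conflict_prog_def conflict_entry_def run_if_eq run_if_conflict run_emit_scaled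
      ready_def[of h])

lemma run_parallel_prog:
  assumes "ready h"
  shows "run tp parallel_prog (h, out) =
    (h, out @ scaled_code (h 1) (parallel_entry tp (h 3) (h 4) (h 5) (h 6)))"
  using assms run_emit_scaled[OF assms]
  by (simp add: parallel_prog_def parallel_entry_def run_if_eq run_if_less ready_def[of h])

lemma run_clause_prog:
  assumes "ready h"
  shows "run tp clause_prog (h, out) =
    (h, out @ scaled_code (h 1) (clause_entry tp (h 3) (h 4) (h 5) (h 6)))"
proof -
  have reset: "h(10 := 0) = h"
    using assms by (auto simp: ready_def)
  have le: "clause_start tp (h 5) \<le> length tp"
    using assms clause_start_le[of "h 5"] by (auto simp: ready_def)
  have "run tp (find_clause 5 10 ;;
        if_eq 10 3 (clear 10 ;; P') (clear 10 ;; Q')) (h, out)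
      = run tp (if clause_start tp (h 5) = h 3 then P' else Q') (h, out)" for P' Q'
    using assms le reset by (simp add: ready_def run_find_clause run_if_eq run_clear)
  with assms run_emit_scaled[OF assms] show ?thesis
    by (simp add: clause_prog_def clause_entry_def run_if_eq ready_def[of h])
qed

definition stationary :: "nat \<Rightarrow> nat \<Rightarrow> store \<Rightarrow> bool" where
  "stationary n a h \<longleftrightarrow> h 0 = n \<and> h 1 = a \<and> (\<forall>r \<in> {2..16}. h r = 0) \<and> h 17 = length tp"

text \<open>The nested loops are treated from the inside out. Each level restores the store, so the
  next one is again an instance of \<open>run_for\<close>.\<close>

lemma run_matrix_loop:
  assumes h: "stationary n a h" and n: "n \<le> length tp" and a: "a \<le> length tp"
    and P: "\<And>h out. ready h \<Longrightarrow>
      run tp P (h, out) = (h, out @ scaled_code (h 1) (e (h 3) (h 4) (h 5) (h 6)))"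
  shows "run tp (matrix_loop P) (h, out) = (h, out @ matrices_code n a e)"
proof -
  have cols: "run tp (for_loop 6 16 (Emit True ;; P)) (h, out) =
      (h, out @ concat (map (\<lambda>c. True # scaled_code a (e (h 3) (h 4) (h 5) c)) [0..<n]))"
    if "ready h" "h 0 = n" "h 1 = a" "h 6 = 0" "h 16 = 0" for h out
  proof (rule run_for)
    fix j m out assume "j < n"
    then have "ready (h(16 := m, 6 := j))" using that n by (simp add: ready_def)
    from P[OF this] that show "run tp (Emit True ;; P) (h(16 := m, 6 := j), out) =
        (h(16 := m, 6 := j), out @ True # scaled_code a (e (h 3) (h 4) (h 5) j))" by simp
  qed (use that n in \<open>simp_all add: ready_def\<close>)
  let ?row = "\<lambda>p q r. enc_list (scaled_code a) (map (e p q r) [0..<n])"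
  have row: "concat (map (\<lambda>c. True # scaled_code a (e p q r c)) [0..<n]) @ [False] = ?row p q r"
    for p q r by (simp add: enc_list_def comp_def)
  have rows: "run tp (for_loop 5 15 (Emit True ;; for_loop 6 16 (Emit True ;; P) ;; Emit False)) (h, out) =
      (h, out @ concat (map (\<lambda>r. True # ?row (h 3) (h 4) r) [0..<n]))"
    if "ready h" "h 0 = n" "h 1 = a" "\<forall>r \<in> {5, 6, 15, 16}. h r = 0" for h out
  proof (rule run_for)
    fix j m out assume "j < n"
    then have "ready (h(15 := m, 5 := j))" using that n by (simp add: ready_def)
    from cols[OF this] that row[of "h 3" "h 4" j]
    show "run tp (Emit True ;; for_loop 6 16 (Emit True ;; P) ;; Emit False) (h(15 := m, 5 := j), out) =
        (h(15 := m, 5 := j), out @ True # ?row (h 3) (h 4) j)" by simp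
  qed (use that n in \<open>simp_all add: ready_def\<close>)
  have mat: "concat (map (\<lambda>r. True # ?row p q r) [0..<n]) @ [False] = matrix_code n a (e p q)"
    for p q by (simp add: matrix_code_def enc_list_def[of "enc_list (scaled_code a)"] comp_def)
  have q_loop: "run tp (for_loop 4 14 (Emit True ;;
       for_loop 5 15 (Emit True ;; for_loop 6 16 (Emit True ;; P) ;; Emit False) ;; Emit False)) (h, out) =
      (h, out @ concat (map (\<lambda>q. True # matrix_code n a (e (h 3) q)) [0..<n]))"
    if "ready h" "h 0 = n" "h 1 = a" "\<forall>r \<in> {4, 5, 6, 14, 15, 16}. h r = 0" for h out
  proof (rule run_for)
    fix j m out assume "j < n"
    then have "ready (h(14 := m, 4 := j))" using that n by (simp add: ready_def)
    from rows[OF this] that mat[of "h 3" j]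
    show "run tp (Emit True ;; for_loop 5 15 (Emit True ;; for_loop 6 16 (Emit True ;; P) ;; Emit False)
          ;; Emit False) (h(14 := m, 4 := j), out) =
        (h(14 := m, 4 := j), out @ True # matrix_code n a (e (h 3) j))" by simp
  qed (use that n in \<open>simp_all add: ready_def\<close>)
  have p_loop: "run tp (for_loop 3 13 (for_loop 4 14 (Emit True ;;
       for_loop 5 15 (Emit True ;; for_loop 6 16 (Emit True ;; P) ;; Emit False) ;; Emit False))) (h, out) =
      (h, out @ concat (map (\<lambda>p. concat (map (\<lambda>q. True # matrix_code n a (e p q)) [0..<n])) [0..<n]))"
    if "ready h" "h 0 = n" "h 1 = a" "\<forall>r \<in> {3, 4, 5, 6, 13, 14, 15, 16}. h r = 0" for h out
  proof (rule run_for)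
    fix j m out assume "j < n"
    then have "ready (h(13 := m, 3 := j))" using that n by (simp add: ready_def)
    from q_loop[OF this] that
    show "run tp (for_loop 4 14 (Emit True ;;
       for_loop 5 15 (Emit True ;; for_loop 6 16 (Emit True ;; P) ;; Emit False) ;; Emit False))
          (h(13 := m, 3 := j), out) =
        (h(13 := m, 3 := j), out @ concat (map (\<lambda>q. True # matrix_code n a (e j q)) [0..<n]))" by simp
  qed (use that n in \<open>simp_all add: ready_def\<close>)
  have ready: "ready h" using h n a by (simp add: ready_def stationary_def)
  show ?thesis
    unfolding matrix_loop_def matrices_code_def
  proof (rule run_for)
    fix j m out assume "j < n"
    then have "ready (h(12 := m, 2 := j))" using ready by (simp add: ready_def)
    from p_loop[OF this] h
    show "run tp (for_loop 3 13 (for_loop 4 14 (Emit True ;;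
       for_loop 5 15 (Emit True ;; for_loop 6 16 (Emit True ;; P) ;; Emit False) ;; Emit False)))
          (h(12 := m, 2 := j), out) = (h(12 := m, 2 := j),
          out @ concat (map (\<lambda>p. concat (map (\<lambda>q. True # matrix_code n a (e p q)) [0..<n])) [0..<n]))"
      by (simp add: stationary_def)
  qed (use h n in \<open>simp_all add: stationary_def\<close>)
qed

lemma exponent_bounds:
  assumes "2 \<le> length tp"
  shows "2 ^ exponent tp < length tp" "length tp \<le> 2 * 2 ^ exponent tp" "exponent tp < length tp"
    and "a < exponent tp \<Longrightarrow> 2 * 2 ^ a < length tp"
proof -
  have "length tp \<le> 2 * 2 ^ length tp"
    using less_exp[of "length tp"] by linarith
  then show "length tp \<le> 2 * 2 ^ exponent tp" unfolding exponent_def by (rule LeastI)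
  show small: "2 * 2 ^ a < length tp" if "a < exponent tp" for a
    using not_less_Least[OF that[unfolded exponent_def]] by simp
  show less: "2 ^ exponent tp < length tp"
  proof (cases "exponent tp")
    case (Suc a)
    with small[of a] show ?thesis by simp
  qed (use assms in simp)
  show "exponent tp < length tp" using less less_exp[of "exponent tp"] by linarith
qed

lemma run_double_step:
  assumes "h 7 = 0" "h 8 = 0" "h 9 = 0" "h 0 < length tp" "h 1 < length tp"
  shows "run tp double_step (h, out) =
    (if 2 * h 0 < length tp then h(0 := 2 * h 0, 1 := Suc (h 1)) else h, out)"
proof -
  let ?N = "h 0" and ?B = "length tp"
  have 1: "run tp (Down 8 (Inc 7)) (h(7 := ?N, 8 := ?N), out)
      = ((h(7 := min ?B (?N + (?N - 0))))(8 := 0), out)"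
    by (rule run_Down[where g = "\<lambda>i. h(7 := min ?B (?N + (?N - i)))" and b = "\<lambda>_. out" and k = ?N])
      (use assms in \<open>auto simp: fun_eq_iff symbol_at_0_iff\<close>)
  have 2: "h(7 := min ?B (?N + ?N), 8 := 0) = h(7 := min ?B (?N + ?N))" "h(7 := 0) = h"
    using assms by auto
  have 3: "h(7 := v, 0 := w, 7 := 0, 1 := x) = h(0 := w, 1 := x)" for v w x
    using assms by auto
  show ?thesis
    using assms 1 2 3 by (simp add: double_step_def run_copy run_clear symbol_at_0_iff mult_2)
qed

lemma run_clear_list:
  "run tp (foldr (\<lambda>r p. clear r ;; p) rs Skip) (h, out) = (\<lambda>r. if r \<in> set rs then 0 else h r, out)"
  by (induction rs arbitrary: h) (auto simp: run_clear fun_eq_iff)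

lemma run_setup:
  assumes "2 \<le> length tp"
  obtains h where "run tp setup_prog (\<lambda>_. length tp, []) = (h, [])"
    "stationary (2 ^ exponent tp) (exponent tp) h"
proof -
  let ?B = "length tp"
  define h where "h = (\<lambda>r :: nat. if r < 17 then 0 else ?B)"
  \<comment> \<open>With \<open>i\<close> rounds left, \<open>?B - i\<close> doublings have been
    tried, and precisely the first \<open>exponent tp\<close> attempts succeed.\<close>
  define g where "g i = h(0 := 2 ^ min (?B - i) (exponent tp), 1 := min (?B - i) (exponent tp))" for i
  note bounds = exponent_bounds[OF assms]
  have 1: "run tp (Down 10 double_step) (h(0 := 1, 10 := ?B), []) = ((g 0)(10 := 0), [])"
  proof (rule run_Down[where b = "\<lambda>_. []" and k = ?B])
    fix i assume i: "i < ?B"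
    define j where "j = ?B - Suc i"
    have j: "?B - i = Suc j" using i by (simp add: j_def)
    have "2 ^ min j (exponent tp) \<le> (2 :: nat) ^ exponent tp" by (intro power_increasing) auto
    from le_less_trans[OF this bounds(1)] bounds(3)
    have lt: "2 ^ min j (exponent tp) < ?B" "min j (exponent tp) < ?B" by simp_all
    have "run tp double_step ((g (Suc i))(10 := i), []) =
        (if 2 * 2 ^ min j (exponent tp) < ?B
         then ((g (Suc i))(10 := i))(0 := 2 * 2 ^ min j (exponent tp), 1 := Suc (min j (exponent tp)))
         else (g (Suc i))(10 := i), [])"
      using lt by (subst run_double_step) (simp_all add: g_def h_def j_def)
    also have "\<dots> = ((g i)(10 := i), [])"
    proof (cases "j < exponent tp")
      case True
      then show ?thesis using bounds(4)[of j] by (auto simp: g_def j fun_eq_iff min_def Suc_le_eq j_def[symmetric])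
    next
      case False
      then show ?thesis using bounds(2) by (auto simp: g_def j fun_eq_iff min_def j_def[symmetric])
    qed
    finally show "run tp double_step ((g (Suc i))(10 := i), []) = ((g i)(10 := i), [])" .
  qed (simp_all add: g_def h_def fun_eq_iff)
  have "tp \<noteq> []" using assms by auto
  with 1 have "run tp setup_prog (\<lambda>_. ?B, []) = ((g 0)(10 := 0), [])"
    by (simp add: setup_prog_def run_clear_list h_def[symmetric] run_copy symbol_at_0_iff)
      (simp add: h_def run_copy)
  moreover have "stationary (2 ^ exponent tp) (exponent tp) ((g 0)(10 := 0))"
    using bounds(3) by (simp add: stationary_def g_def h_def min_def)
  ultimately show ?thesis using that by blast
qed

lemma run_reduction_prog:
  assumes "2 \<le> length tp"
  defines "n \<equiv> 2 ^ exponent tp"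
  shows "snd (run tp reduction_prog (\<lambda>_. length tp, [])) =
    enc_nat n @ enc_nat (4 * n ^ 3) @
    matrices_code n (exponent tp) (conflict_entry tp) @ matrices_code n (exponent tp) (conflict_entry tp) @
    matrices_code n (exponent tp) (parallel_entry tp) @ matrices_code n (exponent tp) (clause_entry tp) @ [False]"
proof -
  obtain h where h: "run tp setup_prog (\<lambda>_. length tp, []) = (h, [])" "stationary n (exponent tp) h"
    using run_setup[OF assms(1)] unfolding n_def by blast
  note bounds = exponent_bounds[OF assms(1)]
  have le: "n \<le> length tp" "exponent tp \<le> length tp" using bounds by (simp_all add: n_def)
  have zeros: "run tp emit_zeros (h, out) = (h, out @ concat (replicate (exponent tp) [True, False]))" for out
    using h(2) le by (subst run_emit_zeros) (simp_all add: stationary_def)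
  note loop = run_matrix_loop[OF h(2) le]
  have "4 * n ^ 3 = 2 ^ (exponent tp + (exponent tp + (exponent tp + 2)))"
    by (simp add: n_def power_add power3_eq_cube)
  then have m: "enc_nat (4 * n ^ 3) = concat (replicate (exponent tp) [True, False]) @
      concat (replicate (exponent tp) [True, False]) @ concat (replicate (exponent tp) [True, False]) @
      [True, False, True, False, True, True, False]"
    by (simp only: enc_nat_power replicate_add concat_append) (simp add: numeral_2_eq_2)
  show ?thesis
    by (simp add: reduction_prog_def h(1) zeros run_emit_list loop run_conflict_prog
        run_parallel_prog run_clause_prog m) (simp add: n_def enc_nat_power)
qed

end

section \<open>Formulas as tapes\<close>

definition digit_symbols :: "nat \<Rightarrow> nat list" where
  "digit_symbols v = map (\<lambda>b. if b then 9 else 8) (binary_digits v)"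

lemma digit_symbols_inject: "digit_symbols v = digit_symbols w \<Longrightarrow> v = w"
proof -
  assume *: "digit_symbols v = digit_symbols w"
  have "inj (\<lambda>b. if b then 9 else 8 :: nat)" by (rule injI) (auto split: if_splits)
  then have "binary_digits v = binary_digits w"
    using * unfolding digit_symbols_def by (simp add: inj_map_eq_map)
  then show "v = w" by (rule binary_digits_inject)
qed

lemma set_digit_symbols: "set (digit_symbols v) \<subseteq> {8, 9}"
  by (auto simp: digit_symbols_def)

definition sign_symbol :: "bool \<Rightarrow> nat" where
  "sign_symbol s = (if s then 7 else 6)"

lemma literal_symbols_eq: "literal_symbols l = sign_symbol (fst l) # digit_symbols (snd l)"
  by (cases l) (simp add: sign_symbol_def digit_symbols_def)

lemma symbol_at_append:
  "symbol_at (xs @ ys) i = (if i < length xs then symbol_at xs i else symbol_at ys (i - length xs))"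
  by (auto simp: symbol_at_def nth_append)

lemma symbol_at_in_set: "symbol_at xs i = x \<Longrightarrow> x \<noteq> 0 \<Longrightarrow> x \<in> set xs"
  by (auto simp: symbol_at_def split: if_splits)

definition literal_at :: "nat list \<Rightarrow> nat \<Rightarrow> bool" where
  "literal_at tp r \<longleftrightarrow> symbol_at tp r \<in> {6, 7}"

definition members :: "nat list \<Rightarrow> nat \<Rightarrow> nat set" where
  "members tp p = {r. literal_at tp r \<and> clause_start tp r = p}"

lemma clause_start_eq_iff:
  assumes "symbol_at tp p = 5"
  shows "clause_start tp r = p \<longleftrightarrow> p \<le> r \<and> (\<forall>k. p < k \<and> k \<le> r \<longrightarrow> symbol_at tp k \<noteq> 5)"
\<comment> \<open>The value 0 of \<open>clause_start\<close> is also its default, so a clause symbol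
  at 0 is treated separately.\<close>
proof (cases "symbol_at tp 0 = 5 \<and> p = 0")
  case True
  show ?thesis
  proof (induction r)
    case (Suc r)
    with True show ?case by (auto simp: le_Suc_eq)
  qed (use True in auto)
next
  case False
  show ?thesis
  proof (induction r)
    case 0
    with False assms show ?case by auto
  next
    case (Suc r)
    with assms show ?case by (auto simp: le_Suc_eq)
  qed
qed

lemma symbol_at_clause_start:
  assumes "symbol_at tp k = 5" "k \<le> r"
  shows "symbol_at tp (clause_start tp r) = 5"
  using assms(2,1) by (induction r) (auto simp: le_Suc_eq)

lemma digits_at_append:
  assumes "rest = [] \<or> hd rest \<notin> {8, 9}"
  shows "digits_at (u @ digit_symbols v @ rest) (length u) = digit_symbols v"
proof -
  have "takeWhile (\<lambda>s. s \<in> {8, 9}) rest = []" using assms by (cases rest) auto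
  then show ?thesis
    using set_digit_symbols[of v] by (simp add: digits_at_def takeWhile_append2 subset_iff)
qed

definition literal_positions :: "nat list \<Rightarrow> nat set" where
  "literal_positions xs = {r. literal_at xs r}"

lemma literal_positions_append:
  "literal_positions (xs @ ys) = literal_positions xs \<union> (+) (length xs) ` literal_positions ys"
proof -
  have "literal_at xs r \<Longrightarrow> r < length xs" for r
    by (auto simp: literal_at_def symbol_at_def split: if_splits)
  moreover have "\<exists>r'. r = length xs + r' \<and> literal_at ys r'"
    if "literal_at (xs @ ys) r" "\<not> r < length xs" for r
    using that by (intro exI[of _ "r - length xs"]) (auto simp: literal_at_def symbol_at_append)
  ultimately show ?thesis
    by (auto simp: literal_positions_def literal_at_def symbol_at_append)
qed

lemma literal_positions_literal: "literal_positions (literal_symbols l) = {0}"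
proof -
  have "\<not> literal_at (literal_symbols l) (Suc r)" for r
  proof -
    have "digit_symbols (snd l) ! r \<in> {8, 9}" if "r < length (digit_symbols (snd l))"
      using set_digit_symbols[of "snd l"] nth_mem[OF that] by blast
    then show ?thesis by (auto simp: literal_at_def symbol_at_def literal_symbols_eq)
  qed
  moreover have "literal_at (literal_symbols l) 0"
    by (simp add: literal_at_def symbol_at_def literal_symbols_eq sign_symbol_def)
  ultimately show ?thesis
    unfolding literal_positions_def by (auto, metis not0_implies_Suc)
qed

lemma five_notin_literal: "5 \<notin> set (literal_symbols l)"
  using set_digit_symbols[of "snd l"] by (auto simp: literal_symbols_eq sign_symbol_def)

text \<open>After the symbol 5 come three literals with one sign symbol each. The first condition on
  \<open>post\<close> keeps the digits of the last literal from running on; the second ensures that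
  later sign symbols belong to later clauses.\<close>

lemma members_block:
  fixes a b c :: literal
  assumes tp: "tp = pre @ clause_symbols (a, b, c) @ post"
    and post: "post = [] \<or> hd post \<notin> {8, 9}" "hd post = 5 \<and> post \<noteq> [] \<or> set post \<inter> {6, 7} = {}"
  shows "symbol_at tp (length pre) = 5"
    and "card (members tp (length pre)) = 3"
    and "(\<lambda>r. (symbol_at tp r, digits_at tp (Suc r))) ` members tp (length pre) =
      (\<lambda>(s, v). (sign_symbol s, digit_symbols v)) ` {a, b, c}"
proof -
  define p where "p = length pre"
  define la where "la = length (literal_symbols a)"
  define lb where "lb = length (literal_symbols b)"
  define body where "body = literal_symbols a @ literal_symbols b @ literal_symbols c"
  have tp': "tp = (pre @ [5]) @ body @ post" by (simp add: tp body_def)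
  have len: "length (pre @ [5]) = Suc p" by (simp add: p_def)
  show five: "symbol_at tp (length pre) = 5"
    by (simp add: tp symbol_at_append) (simp add: symbol_at_def)
  \<comment> \<open>The signs sit at the starts of the three literals.\<close>
  have body_pos: "literal_positions body = {0, la, la + lb}"
    by (auto simp: body_def literal_positions_append literal_positions_literal la_def lb_def)
  have after: "symbol_at tp (Suc p + i) = symbol_at (body @ post) i" for i
    unfolding tp' by (subst symbol_at_append) (simp add: p_def)
  have no5: "symbol_at body i \<noteq> 5" for i
    using symbol_at_in_set[of body i 5] five_notin_literal[of a] five_notin_literal[of b]
      five_notin_literal[of c] by (auto simp: body_def)
  have pos: "la < length body" "la + lb < length body" "0 < la" "0 < lb"
    by (auto simp: body_def la_def lb_def literal_symbols_eq)
  have members: "members tp p = {Suc p, Suc p + la, Suc p + (la + lb)}"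
  proof (intro equalityI subsetI)
    fix r assume r: "r \<in> members tp p"
    then have lit: "literal_at tp r" and start: "p \<le> r" "\<And>k. p < k \<Longrightarrow> k \<le> r \<Longrightarrow> symbol_at tp k \<noteq> 5"
      using clause_start_eq_iff[OF five] by (auto simp: members_def p_def)
    have "r \<noteq> p" using lit five by (auto simp: literal_at_def p_def)
    then obtain i where i: "r = Suc p + i" using start(1) less_imp_Suc_add[of p r] by auto
    have li: "literal_at (body @ post) i" using lit unfolding i literal_at_def after .
    have "i < length body"
    proof (rule ccontr)
      assume ge: "\<not> i < length body"
      with li have "symbol_at post (i - length body) \<in> {6, 7}"
        by (simp add: literal_at_def symbol_at_append)
      then have "set post \<inter> {6, 7} \<noteq> {}"
        using symbol_at_in_set[of post "i - length body"] by auto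
      \<comment> \<open>A sign beyond the body would have the next clause symbol between itself and
        \<open>p\<close>, contradicting \<open>start\<close>.\<close>
      with post(2) have "hd post = 5" "post \<noteq> []" by auto
      then have "symbol_at tp (Suc p + length body) = 5"
        unfolding after by (simp add: symbol_at_append) (simp add: symbol_at_def hd_conv_nth)
      with start(2)[of "Suc p + length body"] ge i show False by simp
    qed
    with li have "i \<in> literal_positions body"
      by (simp add: literal_at_def symbol_at_append literal_positions_def)
    with body_pos i show "r \<in> {Suc p, Suc p + la, Suc p + (la + lb)}" by auto
  next
    fix r assume "r \<in> {Suc p, Suc p + la, Suc p + (la + lb)}"
    then obtain i where i: "r = Suc p + i" "i \<in> literal_positions body" using body_pos by auto
    then have "i < length body" using body_pos pos by auto
    then have lit: "literal_at tp r"
      using i(2) unfolding i literal_at_def after by (simp add: symbol_at_append literal_positions_def literal_at_def)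
    have "symbol_at tp k \<noteq> 5" if "p < k" "k \<le> r" for k
    proof -
      obtain j where j: "k = Suc p + j" using less_imp_Suc_add[OF \<open>p < k\<close>] by auto
      then show ?thesis
        using that i(1) \<open>i < length body\<close> no5[of j] unfolding j after by (simp add: symbol_at_append)
    qed
    with lit i(1) show "r \<in> members tp p"
      using clause_start_eq_iff[OF five] by (auto simp: members_def p_def)
  qed
  then show "card (members tp (length pre)) = 3" using pos by (simp add: p_def)
  have at: "symbol_at tp (length u) = sign_symbol (fst l)"
      "digits_at tp (Suc (length u)) = digit_symbols (snd l)"
    if "tp = u @ literal_symbols l @ rest" "rest = [] \<or> hd rest \<notin> {8, 9}" for u l rest
  proof -
    show "symbol_at tp (length u) = sign_symbol (fst l)"
      by (simp add: that symbol_at_append) (simp add: symbol_at_def literal_symbols_eq)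
    show "digits_at tp (Suc (length u)) = digit_symbols (snd l)"
      using digits_at_append[OF that(2), of "u @ [sign_symbol (fst l)]" "snd l"]
      by (simp add: that(1) literal_symbols_eq)
  qed
  have hd: "hd (literal_symbols l @ ys) \<notin> {8, 9}" for l ys
    by (simp add: literal_symbols_eq sign_symbol_def)
  have "symbol_at tp (Suc p) = sign_symbol (fst a)" "digits_at tp (Suc (Suc p)) = digit_symbols (snd a)"
    using at[of "pre @ [5]" a "literal_symbols b @ literal_symbols c @ post"] hd
    by (simp_all add: tp p_def)
  moreover have "symbol_at tp (Suc p + la) = sign_symbol (fst b)"
    "digits_at tp (Suc (Suc p + la)) = digit_symbols (snd b)"
    using at[of "pre @ [5] @ literal_symbols a" b "literal_symbols c @ post"] hd
    by (simp_all add: tp p_def la_def)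
  moreover have "symbol_at tp (Suc p + (la + lb)) = sign_symbol (fst c)"
    "digits_at tp (Suc (Suc p + (la + lb))) = digit_symbols (snd c)"
    using at[of "pre @ [5] @ literal_symbols a @ literal_symbols b" c post] post(1)
    by (simp_all add: tp p_def la_def lb_def)
  ultimately show "(\<lambda>r. (symbol_at tp r, digits_at tp (Suc r))) ` members tp (length pre) =
      (\<lambda>(s, v). (sign_symbol s, digit_symbols v)) ` {a, b, c}"
    using members by (simp add: p_def case_prod_beta)
qed

text \<open>Within a clause the symbol 5 occurs only in front, so every occurrence marks a boundary
  between clauses.\<close>

lemma clause_position_split:
  assumes "symbol_at (concat (map clause_symbols F)) i = 5"
  obtains F1 C F2 where "F = F1 @ C # F2" "i = length (concat (map clause_symbols F1))"
  using assms
proof (induction F arbitrary: i thesis)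
  case Nil
  then show ?case by (simp add: symbol_at_def)
next
  case (Cons C F)
  show ?case
  proof (cases "i < length (clause_symbols C)")
    case True
    obtain a b c where C: "C = (a, b, c)" by (cases C)
    have "symbol_at (clause_symbols C) i = 5" using Cons.prems(2) True by (simp add: symbol_at_append)
    then have "i = 0"
      using symbol_at_in_set[of "literal_symbols a @ literal_symbols b @ literal_symbols c" "i - 1" 5]
        five_notin_literal[of a] five_notin_literal[of b] five_notin_literal[of c]
      by (cases i) (auto simp: C symbol_at_def split: if_splits)
    then show ?thesis using Cons.prems(1)[of "[]" C F] by simp
  next
    case False
    then have "symbol_at (concat (map clause_symbols F)) (i - length (clause_symbols C)) = 5"
      using Cons.prems(2) by (simp add: symbol_at_append)
    then obtain F1 C' F2 where "F = F1 @ C' # F2"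
      "i - length (clause_symbols C) = length (concat (map clause_symbols F1))"
      using Cons.IH by blast
    then show ?thesis using False by (intro Cons.prems(1)[of "C # F1" C' F2]) auto
  qed
qed

definition clause_literals :: "clause3 \<Rightarrow> literal set" where
  "clause_literals C = {fst C, fst (snd C), snd (snd C)}"

lemma clause_true_iff: "clause_true \<sigma> C \<longleftrightarrow> (\<exists>(s, v) \<in> clause_literals C. \<sigma> v = s)"
  by (cases C) (auto simp: clause_literals_def)

text \<open>The number of positions is recorded separately from the set of literals: literals of a
  clause may coincide, but their positions are distinct, and the Gram sum counts positions.\<close>

definition spells :: "nat list \<Rightarrow> nat \<Rightarrow> clause3 \<Rightarrow> bool" where
  "spells tp p C \<longleftrightarrow> symbol_at tp p = 5 \<and> card (members tp p) = 3 \<and>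
     (\<lambda>r. (symbol_at tp r, digits_at tp (Suc r))) ` members tp p =
       (\<lambda>(s, v). (sign_symbol s, digit_symbols v)) ` clause_literals C"

lemma formula_tape_spells:
  assumes "F = F1 @ C # F2"
  shows "spells (formula_tape F) (2 + length (concat (map clause_symbols F1))) C"
proof -
  obtain a b c where C: "C = (a, b, c)" by (cases C)
  define pre where "pre = [3, 4] @ concat (map clause_symbols F1)"
  define post where "post = concat (map clause_symbols F2) @ replicate (length (enc_list enc_clause F)) 10"
  have tp: "formula_tape F = pre @ clause_symbols (a, b, c) @ post"
    by (simp add: formula_tape_def assms C pre_def post_def)
  \<comment> \<open>Behind a clause comes the next clause symbol or the padding.\<close>
  have "post = [] \<or> hd post \<notin> {8, 9} \<and> (hd post = 5 \<or> set post \<inter> {6, 7} = {})"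
  proof (cases F2)
    case Nil
    then show ?thesis
      by (cases "length (enc_list enc_clause F)") (simp_all add: post_def)
  next
    case (Cons C' F')
    then show ?thesis by (cases C') (simp add: post_def)
  qed
  then have "post = [] \<or> hd post \<notin> {8, 9}" "hd post = 5 \<and> post \<noteq> [] \<or> set post \<inter> {6, 7} = {}"
    by auto
  from members_block[OF tp this] show ?thesis
    by (simp add: spells_def clause_literals_def C pre_def)
qed

lemma formula_tape_symbols:
  shows "symbol_at (formula_tape F) 0 = 3" "symbol_at (formula_tape F) (Suc 0) = 4"
    and "symbol_at (formula_tape F) (Suc (Suc i)) =
      (if i < length (concat (map clause_symbols F)) then symbol_at (concat (map clause_symbols F)) i
       else if i < length (concat (map clause_symbols F)) + length (enc_list enc_clause F) then 10 else 0)"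
  by (auto simp: formula_tape_def symbol_at_def nth_append)

lemma formula_tape_clause_position:
  assumes "symbol_at (formula_tape F) p = 5"
  obtains C where "C \<in> set F" "spells (formula_tape F) p C"
proof -
  obtain i where p: "p = Suc (Suc i)"
    using assms formula_tape_symbols(1,2)[of F] by (cases p; cases "p - 1") auto
  then have "symbol_at (concat (map clause_symbols F)) i = 5"
    using assms formula_tape_symbols(3)[of F i] by (simp split: if_splits)
  then obtain F1 C F2 where *: "F = F1 @ C # F2" "i = length (concat (map clause_symbols F1))"
    by (rule clause_position_split)
  with formula_tape_spells[OF *(1)] p that[of C] show ?thesis by simp
qed

lemma formula_tape_clause:
  assumes "C \<in> set F"
  obtains p where "spells (formula_tape F) p C"
proof -
  obtain F1 F2 where "F = F1 @ C # F2" using assms by (auto simp: in_set_conv_decomp)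
  from formula_tape_spells[OF this] that show ?thesis by blast
qed

text \<open>A literal exists only if there is a clause, and the first clause starts at position 2.
  So \<open>clause_start\<close> does not fall back to its default.\<close>

lemma formula_tape_literal_start:
  assumes "literal_at (formula_tape F) r"
  shows "symbol_at (formula_tape F) (clause_start (formula_tape F) r) = 5"
proof -
  let ?A = "concat (map clause_symbols F)"
  obtain i where r: "r = Suc (Suc i)"
    using assms formula_tape_symbols(1,2)[of F] by (cases r; cases "r - 1") (auto simp: literal_at_def)
  have "F \<noteq> []"
    using assms formula_tape_symbols(3)[of F i] by (auto simp: r literal_at_def split: if_splits)
  then obtain C F' where F: "F = C # F'" by (cases F) auto
  then have "symbol_at (formula_tape F) (Suc (Suc 0)) = 5"
    using formula_tape_symbols(3)[of F 0] by (cases C) (simp add: symbol_at_def)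
  then show ?thesis by (rule symbol_at_clause_start) (simp add: r)
qed

section \<open>Bilinear systems of formulas\<close>

text \<open>These sets are the supports of solutions without coordinate 0; they separate the
  combinatorics from the algebra.\<close>

definition selection :: "nat list \<Rightarrow> nat set \<Rightarrow> bool" where
  "selection tp X \<longleftrightarrow> (\<forall>r \<in> X. literal_at tp r) \<and> (\<forall>p \<in> X. \<forall>q \<in> X. \<not> conflict tp p q) \<and>
     (\<forall>p. symbol_at tp p = 5 \<longrightarrow> X \<inter> members tp p \<noteq> {})"

lemma spells_member:
  assumes "spells tp p C" "r \<in> members tp p"
  obtains s v where "(s, v) \<in> clause_literals C" "symbol_at tp r = sign_symbol s"
    "digits_at tp (Suc r) = digit_symbols v"
  using assms unfolding spells_def by (fastforce simp: image_iff set_eq_iff)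

lemma spells_literal:
  assumes "spells tp p C" "(s, v) \<in> clause_literals C"
  obtains r where "r \<in> members tp p" "symbol_at tp r = sign_symbol s"
    "digits_at tp (Suc r) = digit_symbols v"
proof -
  have "(sign_symbol s, digit_symbols v) \<in>
      (\<lambda>r. (symbol_at tp r, digits_at tp (Suc r))) ` members tp p"
    using assms unfolding spells_def by (auto intro: rev_image_eqI)
  with that show ?thesis by auto
qed

lemma conflict_literal:
  assumes "conflict tp p q" "symbol_at tp p \<in> {6, 7}"
  shows "p \<noteq> q \<and> (clause_start tp p = clause_start tp q \<or>
    symbol_at tp p \<noteq> symbol_at tp q \<and> digits_at tp (Suc p) = digits_at tp (Suc q))"
  using assms by (auto simp: conflict_def split: if_splits)

text \<open>From an assignment, one true literal is chosen in each clause. Conversely, the variables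
  of the selected positive literals are made true.\<close>

lemma satisfiable_iff_selection: "satisfiable F \<longleftrightarrow> (\<exists>X. selection (formula_tape F) X)"
proof
  let ?tp = "formula_tape F"
  let ?s = "symbol_at ?tp" and ?d = "\<lambda>r. digits_at ?tp (Suc r)"
  assume "satisfiable F"
  then obtain \<sigma> where \<sigma>: "\<And>C. C \<in> set F \<Longrightarrow> clause_true \<sigma> C" unfolding satisfiable_def by blast
  have "\<exists>r v. r \<in> members ?tp p \<and> ?s r = sign_symbol (\<sigma> v) \<and> ?d r = digit_symbols v"
    if "?s p = 5" for p
  proof -
    obtain C where C: "C \<in> set F" "spells ?tp p C"
      using formula_tape_clause_position[OF \<open>?s p = 5\<close>] by blast
    then obtain v where "(\<sigma> v, v) \<in> clause_literals C"
      using \<sigma>[OF C(1)] by (auto simp: clause_true_iff)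
    from spells_literal[OF C(2) this] show ?thesis by blast
  qed
  then obtain r v where rv: "\<And>p. ?s p = 5 \<Longrightarrow>
      r p \<in> members ?tp p \<and> ?s (r p) = sign_symbol (\<sigma> (v p)) \<and> ?d (r p) = digit_symbols (v p)"
    by metis
  have "\<not> conflict ?tp (r p) (r q)" if "?s p = 5" "?s q = 5" for p q
  proof
    assume c: "conflict ?tp (r p) (r q)"
    have lit: "?s (r p) \<in> {6, 7}" and start: "clause_start ?tp (r p) = p" "clause_start ?tp (r q) = q"
      using rv[OF that(1)] rv[OF that(2)] by (auto simp: members_def literal_at_def)
    \<comment> \<open>Only one position is chosen per clause, so two distinct chosen positions lie
      in different clauses and can conflict only by being complementary.\<close>
    from conflict_literal[OF c lit] start have "?s (r p) \<noteq> ?s (r q)" "?d (r p) = ?d (r q)"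
      by metis+
    moreover have "v p = v q"
      using rv[OF that(1)] rv[OF that(2)] \<open>?d (r p) = ?d (r q)\<close>
      by (intro digit_symbols_inject) metis
    ultimately show False using rv[OF that(1)] rv[OF that(2)] by metis
  qed
  then have "selection ?tp {r p | p. ?s p = 5}"
    unfolding selection_def using rv by (auto simp: members_def)
  then show "\<exists>X. selection ?tp X" by blast
next
  let ?tp = "formula_tape F"
  let ?s = "symbol_at ?tp" and ?d = "\<lambda>r. digits_at ?tp (Suc r)"
  assume "\<exists>X. selection ?tp X"
  then obtain X where X: "selection ?tp X" by blast
  \<comment> \<open>Variables that are not selected positively become false, which also covers those
    not selected at all.\<close>
  define \<sigma> where "\<sigma> v \<longleftrightarrow> (\<exists>r \<in> X. ?s r = 7 \<and> ?d r = digit_symbols v)" for v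
  have "clause_true \<sigma> C" if "C \<in> set F" for C
  proof -
    obtain p where p: "spells ?tp p C" using formula_tape_clause[OF \<open>C \<in> set F\<close>] by blast
    then have "X \<inter> members ?tp p \<noteq> {}" using X by (simp add: selection_def spells_def)
    then obtain r where r: "r \<in> X" "r \<in> members ?tp p" by blast
    obtain s v where sv: "(s, v) \<in> clause_literals C" "?s r = sign_symbol s" "?d r = digit_symbols v"
      using spells_member[OF p r(2)] by blast
    have "\<sigma> v = s"
    proof (cases s)
      case True
      with sv r(1) show ?thesis by (auto simp: \<sigma>_def sign_symbol_def)
    next
      case False
      \<comment> \<open>A selected positive occurrence of the same variable would conflict with the
        selected negative one.\<close>
      have "\<not> (?s r' = 7 \<and> ?d r' = digit_symbols v)" if "r' \<in> X" for r'
      proof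
        assume r': "?s r' = 7 \<and> ?d r' = digit_symbols v"
        then have "conflict ?tp r r'"
          using sv False by (auto simp: conflict_def sign_symbol_def)
        with X r(1) that show False by (auto simp: selection_def)
      qed
      with False show ?thesis by (auto simp: \<sigma>_def)
    qed
    with sv(1) show ?thesis by (auto simp: clause_true_iff)
  qed
  then show "satisfiable F" unfolding satisfiable_def by blast
qed

section \<open>Bilinear forms and Gram sums of the constraint matrices\<close>

definition bilinear :: "nat \<Rightarrow> (nat \<Rightarrow> nat \<Rightarrow> int) \<Rightarrow> (nat \<Rightarrow> complex) \<Rightarrow> (nat \<Rightarrow> complex) \<Rightarrow> complex" where
  "bilinear n e x y = (\<Sum>r<n. \<Sum>c<n. x r * of_int (e r c) * y c)"

text \<open>Entry \<open>(i, j)\<close> of \<open>e\<^sup>T * e\<close>; as \<open>e\<close> is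
  real, this is the Gram matrix before scaling.\<close>

definition column_gram :: "nat \<Rightarrow> (nat \<Rightarrow> nat \<Rightarrow> int) \<Rightarrow> nat \<Rightarrow> nat \<Rightarrow> int" where
  "column_gram n e i j = (\<Sum>r<n. e r i * e r j)"

text \<open>A matrix supported in column \<open>q\<close> yields a linear form in \<open>x\<close>
  times \<open>y q\<close>. Conflict matrices, clause matrices and diagonal parallel matrices have
  this shape.\<close>

lemma bilinear_column:
  assumes "q < n"
  shows "bilinear n (\<lambda>r c. if c = q then w r else 0) x y = (\<Sum>r<n. x r * of_int (w r)) * y q"
proof -
  have "(\<Sum>c<n. x r * of_int (if c = q then w r else 0) * y c) = x r * of_int (w r) * y q" for r
    using assms by (subst sum.remove[of _ q]) (auto intro: sum.neutral)
  then show ?thesis by (simp add: bilinear_def sum_distrib_right)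
qed

lemma column_gram_column:
  "column_gram n (\<lambda>r c. if c = q then w r else 0) i j = (if i = q \<and> j = q then \<Sum>r<n. (w r)\<^sup>2 else 0)"
  by (simp add: column_gram_def power2_eq_square)

lemma sum_single: "finite A \<Longrightarrow> g \<in> A \<Longrightarrow> (\<And>r. r \<in> A \<Longrightarrow> r \<noteq> g \<Longrightarrow> f r = 0) \<Longrightarrow> sum f A = f g"
  by (subst sum.remove[of A g]) (auto intro: sum.neutral)

text \<open>The properties of formula tapes that the algebra uses. Only the first \<open>n\<close>
  positions are coordinates, and \<open>symbol_below\<close> says that no clause or literal is cut
  off.\<close>

locale clause_tape =
  fixes tp :: "nat list" and n :: nat
  assumes symbol_3: "symbol_at tp i = 3 \<longleftrightarrow> i = 0"
    and symbol_4: "symbol_at tp i = 4 \<longleftrightarrow> i = 1"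
    and symbol_below: "symbol_at tp i \<in> {5, 6, 7} \<Longrightarrow> i < n"
    and two_le: "2 \<le> n"
    and card_members: "symbol_at tp p = 5 \<Longrightarrow> card (members tp p) = 3"
    and literal_start: "literal_at tp r \<Longrightarrow> symbol_at tp (clause_start tp r) = 5"
begin

lemma members_below: "r \<in> members tp p \<Longrightarrow> r < n"
  using symbol_below by (auto simp: members_def literal_at_def)

definition conflict_weight :: "nat \<Rightarrow> nat \<Rightarrow> nat \<Rightarrow> int" where
  "conflict_weight p q r = (if r = (if conflict tp p q then p else 1) then 2 else 0)"

text \<open>The square sum is 4 in both cases: from the entry -1 and three entries 1, or from the
  single 2 in row 1. The other kinds of matrices are normalized to this value.\<close>

definition clause_weight :: "nat \<Rightarrow> nat \<Rightarrow> int" where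
  "clause_weight p r =
     (if symbol_at tp p = 5 then (if r = 0 then - 1 else if r \<in> members tp p then 1 else 0)
      else if r = 1 then 2 else 0)"

lemma conflict_entry_column:
  "conflict_entry tp p q = (\<lambda>r c. if c = q then conflict_weight p q r else 0)"
  by (auto simp: conflict_entry_def conflict_weight_def symbol_4 fun_eq_iff)

lemma clause_entry_column:
  "clause_entry tp p q = (\<lambda>r c. if c = q then clause_weight p r else 0)"
  by (auto simp: clause_entry_def clause_weight_def symbol_3 symbol_4 members_def literal_at_def
      fun_eq_iff)

lemma parallel_entry_column:
  "parallel_entry tp p p = (\<lambda>r c. if c = p then (if r = 1 then 2 else 0) else 0)"
  by (auto simp: parallel_entry_def symbol_4 fun_eq_iff)

lemma bilinear_conflict:
  assumes "p < n" "q < n"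
  shows "bilinear n (conflict_entry tp p q) x y = 2 * x (if conflict tp p q then p else 1) * y q"
proof -
  have "(\<Sum>r<n. x r * of_int (conflict_weight p q r)) = 2 * x (if conflict tp p q then p else 1)"
    using assms two_le
    by (subst sum_single[of _ "if conflict tp p q then p else 1"]) (auto simp: conflict_weight_def)
  with assms show ?thesis by (simp add: conflict_entry_column bilinear_column)
qed

lemma zero_notin_members: "0 \<notin> members tp p"
  using symbol_3[of 0] by (auto simp: members_def literal_at_def)

lemma sum_clause_weight:
  assumes "symbol_at tp p = 5"
  shows "(\<Sum>r<n. f r * of_int (clause_weight p r)) = (\<Sum>r \<in> members tp p. f r) - (f 0 :: complex)"
proof -
  have "(\<Sum>r<n. f r * of_int (clause_weight p r)) =
      (\<Sum>r \<in> insert 0 (members tp p). f r * of_int (clause_weight p r))"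
    using assms two_le members_below by (intro sum.mono_neutral_right) (auto simp: clause_weight_def)
  also have "\<dots> = - f 0 + (\<Sum>r \<in> members tp p. f r * of_int (clause_weight p r))"
    using assms zero_notin_members finite_subset[of "members tp p" "{..<n}"] members_below
    by (subst sum.insert) (auto simp: clause_weight_def)
  also have "(\<Sum>r \<in> members tp p. f r * of_int (clause_weight p r)) = (\<Sum>r \<in> members tp p. f r)"
    using assms zero_notin_members[of p] by (intro sum.cong) (auto simp: clause_weight_def)
  finally show ?thesis by simp
qed

lemma bilinear_clause:
  assumes "q < n"
  shows "bilinear n (clause_entry tp p q) x y =
    (if symbol_at tp p = 5 then (\<Sum>r \<in> members tp p. x r) - x 0 else 2 * x 1) * y q"
proof -
  have "(\<Sum>r<n. x r * of_int (clause_weight p r)) = 2 * x 1" if "symbol_at tp p \<noteq> 5"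
    using that two_le by (subst sum_single[of _ 1]) (auto simp: clause_weight_def)
  with assms sum_clause_weight[of p x] show ?thesis
    by (simp add: clause_entry_column bilinear_column)
qed

text \<open>For \<open>p < q\<close> the form is twice a 2 by 2 minor of \<open>x\<close> and
  \<open>y\<close>, so it expresses that they are parallel. The diagonal matrices force
  \<open>x 1\<close> to vanish, and \<open>p > q\<close> gives zero matrices, so that all index
  pairs are used.\<close>

lemma bilinear_parallel:
  assumes "p < n" "q < n"
  shows "bilinear n (parallel_entry tp p q) x y =
    (if p = q then 2 * x 1 * y p else if p < q then 2 * (x p * y q - x q * y p) else 0)"
proof (cases p q rule: linorder_cases)
  case equal
  have "(\<Sum>r<n. x r * of_int (if r = 1 then 2 else 0)) = 2 * x 1"
    using two_le by (subst sum_single[of _ 1]) auto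
  with equal assms show ?thesis by (simp add: parallel_entry_column bilinear_column)
next
  case less
  define g where "g r = (if r = p then 2 * x p * y q else if r = q then - 2 * x q * y p else 0)" for r
  have "(\<Sum>c<n. x r * of_int (parallel_entry tp p q r c) * y c) = g r" for r
  proof (cases "r = p \<or> r = q")
    case True
    then show ?thesis
      using less assms by (subst sum_single[of _ "if r = p then q else p"])
        (auto simp: parallel_entry_def g_def)
  qed (use less in \<open>auto simp: parallel_entry_def g_def\<close>)
  then have "bilinear n (parallel_entry tp p q) x y = (\<Sum>r \<in> {..<n}. g r)"
    by (simp add: bilinear_def)
  also have "\<dots> = (\<Sum>r \<in> {p, q}. g r)"
    using assms by (intro sum.mono_neutral_right) (auto simp: g_def)
  finally show ?thesis using less by (simp add: g_def algebra_simps)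
next
  case greater
  then show ?thesis by (simp add: bilinear_def parallel_entry_def)
qed

section \<open>Equivalence of feasibility and selections\<close>

definition feasible :: bool where
  "feasible \<longleftrightarrow> (\<exists>x y. (\<exists>i<n. x i \<noteq> 0) \<and> (\<exists>i<n. y i \<noteq> 0) \<and>
     (\<forall>e \<in> {conflict_entry tp, parallel_entry tp, clause_entry tp}. \<forall>p<n. \<forall>q<n.
        bilinear n (e p q) x y = 0))"

lemma feasible_imp_selection:
  assumes feasible
  shows "\<exists>X. selection tp X"
proof -
  obtain x y i j where j: "j < n" "x j \<noteq> 0" and i: "i < n" "y i \<noteq> 0"
    and zero: "\<And>e p q. e \<in> {conflict_entry tp, parallel_entry tp, clause_entry tp} \<Longrightarrow>
      p < n \<Longrightarrow> q < n \<Longrightarrow> bilinear n (e p q) x y = 0"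
    using assms unfolding feasible_def by blast
  \<comment> \<open>The diagonal parallel matrix at \<open>i\<close> has the form
    \<open>2 * x 1 * y i\<close>, with \<open>y i\<close> nonzero.\<close>
  have x1: "x 1 = 0" using zero[of "parallel_entry tp" i i] i by (simp add: bilinear_parallel)
  have par: "x p * y q = x q * y p" if "p < n" "q < n" for p q
    using zero[of "parallel_entry tp" p q] zero[of "parallel_entry tp" q p] that
    by (cases p q rule: linorder_cases) (auto simp: bilinear_parallel)
  have "x i \<noteq> 0" using par[OF i(1) j(1)] i j by auto
  \<comment> \<open>As \<open>x\<close> and \<open>y\<close> are parallel, the support of
    \<open>x\<close> is contained in that of \<open>y\<close>; products \<open>x p * y q\<close>
    thus become conditions on \<open>x\<close> alone.\<close>
  then have yz: "y p \<noteq> 0" if "p < n" "x p \<noteq> 0" for p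
    using par[OF that(1) i(1)] i that by auto
  have conf: "x p = 0 \<or> x q = 0" if "conflict tp p q" "p < n" "q < n" for p q
    using zero[of "conflict_entry tp" p q] that yz[of q] by (auto simp: bilinear_conflict)
  have clause: "(\<Sum>r \<in> members tp p. x r) = x 0" if "symbol_at tp p = 5" for p
    using zero[of "clause_entry tp" p i] i symbol_below[of p] that by (simp add: bilinear_clause)
  \<comment> \<open>If \<open>x 0\<close> were 0, a nonzero coordinate \<open>j\<close> would be a
    literal, as all other coordinates conflict with themselves. The other literals of its clause
    conflict with \<open>j\<close> and vanish, so the clause equation reads
    \<open>x j = x 0\<close>.\<close>
  have x0: "x 0 \<noteq> 0"
  proof
    assume x0: "x 0 = 0"
    then have "j \<noteq> 0" using j(2) by metis
    have "\<not> conflict tp j j" using conf[of j j] j by auto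
    then have lit: "literal_at tp j" using \<open>j \<noteq> 0\<close> symbol_3[of j] by (auto simp: conflict_def literal_at_def)
    let ?c = "clause_start tp j"
    have jc: "j \<in> members tp ?c" using lit by (simp add: members_def)
    have fin: "finite (members tp ?c)"
      using finite_subset[of "members tp ?c" "{..<n}"] members_below by auto
    have "x r = 0" if "r \<in> members tp ?c" "r \<noteq> j" for r
    proof -
      have "conflict tp j r" using that lit by (auto simp: conflict_def members_def literal_at_def)
      with conf[of j r] j members_below[OF that(1)] show ?thesis by auto
    qed
    with fin jc have "(\<Sum>r \<in> members tp ?c. x r) = x j" by (intro sum_single) auto
    with clause[OF literal_start[OF lit]] x0 j show False by simp
  qed
  define X where "X = {r. literal_at tp r \<and> x r \<noteq> 0}"
  have below: "r < n" if "literal_at tp r" for r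
    using symbol_below[of r] that by (auto simp: literal_at_def)
  have "X \<inter> members tp p \<noteq> {}" if "symbol_at tp p = 5" for p
  proof
    assume "X \<inter> members tp p = {}"
    then have "(\<Sum>r \<in> members tp p. x r) = 0" by (intro sum.neutral) (auto simp: X_def members_def)
    with clause[OF that] x0 show False by simp
  qed
  then have "selection tp X"
    using conf below unfolding selection_def X_def by blast
  then show ?thesis by blast
qed

lemma selection_imp_feasible:
  assumes "selection tp X"
  shows feasible
proof -
  have lit: "\<And>r. r \<in> X \<Longrightarrow> literal_at tp r" and conf: "\<And>p q. p \<in> X \<Longrightarrow> q \<in> X \<Longrightarrow> \<not> conflict tp p q"
    and hit: "\<And>p. symbol_at tp p = 5 \<Longrightarrow> X \<inter> members tp p \<noteq> {}"
    using assms unfolding selection_def by blast+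
  \<comment> \<open>The indicator vector of the selection together with coordinate 0 serves as both
    \<open>x\<close> and \<open>y\<close>.\<close>
  define x :: "nat \<Rightarrow> complex" where "x r = (if r \<in> insert 0 X then 1 else 0)" for r
  have x0: "x 0 = 1" by (simp add: x_def)
  have x1: "x 1 = 0" using lit[of 1] symbol_4[of 1] by (auto simp: x_def literal_at_def)
  have "x p * x q = 0" if "conflict tp p q" for p q
  proof (rule ccontr)
    assume "x p * x q \<noteq> 0"
    then have "p \<in> insert 0 X" "q \<in> insert 0 X" by (auto simp: x_def split: if_splits)
    moreover have "symbol_at tp 0 = 3" using symbol_3 by simp
    ultimately show False
    proof (cases "p = 0 \<or> q = 0")
      case True
      with that \<open>symbol_at tp 0 = 3\<close> show False by (auto simp: conflict_def split: if_splits)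
    qed (use that conf in auto)
  qed
  then have "bilinear n (conflict_entry tp p q) x x = 0" if "p < n" "q < n" for p q
    using that x1 by (auto simp: bilinear_conflict)
  moreover have "bilinear n (parallel_entry tp p q) x x = 0" if "p < n" "q < n" for p q
    using that x1 by (simp add: bilinear_parallel mult.commute)
  moreover have "bilinear n (clause_entry tp p q) x x = 0" if "q < n" for p q
  proof -
    have "(\<Sum>r \<in> members tp p. x r) = x 0" if p: "symbol_at tp p = 5"
    proof -
      obtain r where r: "r \<in> X" "r \<in> members tp p" using hit[OF p] by blast
      \<comment> \<open>The selection hits each clause, and by the conflicts within a clause it hits
        it only once, so the clause sum is 1.\<close>
      have "x r' = 0" if "r' \<in> members tp p" "r' \<noteq> r" for r'
      proof -
        have "conflict tp r r'" using r that by (auto simp: conflict_def members_def literal_at_def)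
        then have "r' \<notin> X" using conf r(1) by blast
        moreover have "r' \<noteq> 0" using that zero_notin_members by metis
        ultimately show ?thesis by (simp add: x_def)
      qed
      moreover have "finite (members tp p)"
        using finite_subset[of "members tp p" "{..<n}"] members_below by auto
      ultimately have "(\<Sum>r \<in> members tp p. x r) = x r" using r by (intro sum_single) auto
      with r(1) show ?thesis by (simp add: x_def)
    qed
    with that x1 show ?thesis by (simp add: bilinear_clause)
  qed
  moreover have "\<exists>i<n. x i \<noteq> 0" using x0 two_le by (intro exI[of _ 0]) auto
  ultimately show ?thesis unfolding feasible_def by (intro exI[of _ x]) auto
qed

text \<open>Column \<open>q\<close> is met by exactly the \<open>n\<close> matrices with second
  index \<open>q\<close>, and each adds 4 to that diagonal entry.\<close>

lemma total_gram_column: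
  assumes "\<And>p q. p < n \<Longrightarrow> q < n \<Longrightarrow> (\<Sum>r<n. (w p q r)\<^sup>2) = (4 :: int)" "i < n" "j < n"
  shows "(\<Sum>p<n. \<Sum>q<n. column_gram n (\<lambda>r c. if c = q then w p q r else 0) i j) =
    (if i = j then 4 * int n else 0)"
proof -
  have "(\<Sum>q<n. column_gram n (\<lambda>r c. if c = q then w p q r else 0) i j) = (if i = j then 4 else 0)"
    if "p < n" for p
    using assms that by (subst sum_single[of _ i]) (auto simp: column_gram_column)
  then show ?thesis by simp
qed

lemma total_gram_conflict:
  assumes "i < n" "j < n"
  shows "(\<Sum>p<n. \<Sum>q<n. column_gram n (conflict_entry tp p q) i j) = (if i = j then 4 * int n else 0)"
  unfolding conflict_entry_column
proof (rule total_gram_column[OF _ assms])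
  fix p q assume "p < n"
  then show "(\<Sum>r<n. (conflict_weight p q r)\<^sup>2) = 4"
    using two_le by (subst sum_single[of _ "if conflict tp p q then p else 1"])
      (auto simp: conflict_weight_def)
qed

lemma total_gram_clause:
  assumes "i < n" "j < n"
  shows "(\<Sum>p<n. \<Sum>q<n. column_gram n (clause_entry tp p q) i j) = (if i = j then 4 * int n else 0)"
  unfolding clause_entry_column
proof (rule total_gram_column[OF _ assms])
  fix p
  show "(\<Sum>r<n. (clause_weight p r)\<^sup>2) = 4"
  proof (cases "symbol_at tp p = 5")
    case True
    have "(\<Sum>r<n. (clause_weight p r)\<^sup>2) = (\<Sum>r \<in> insert 0 (members tp p). 1)"
      using True two_le members_below
      by (intro sum.mono_neutral_cong_right) (auto simp: clause_weight_def)
    also have "\<dots> = 4"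
      using card_members[OF True] zero_notin_members[of p] by (simp add: card_ge_0_finite)
    finally show ?thesis .
  next
    case False
    then show ?thesis using two_le by (subst sum_single[of _ 1]) (auto simp: clause_weight_def)
  qed
qed

text \<open>A matrix with \<open>p < q\<close> adds 4 at both \<open>p\<close> and \<open>q\<close>,
  a diagonal one adds 4 at \<open>p\<close>. The index \<open>i\<close> is paired once with every
  index, which gives \<open>n\<close> contributions.\<close>

lemma total_gram_parallel:
  assumes "i < n" "j < n"
  shows "(\<Sum>p<n. \<Sum>q<n. column_gram n (parallel_entry tp p q) i j) = (if i = j then 4 * int n else 0)"
proof -
  \<comment> \<open>The first summand counts \<open>i\<close> as the larger or equal index of the
    pair, the second as the smaller one.\<close>
  have cg: "column_gram n (parallel_entry tp p q) i j =
      (if i = j then (if q = i \<and> p \<le> i then 4 else 0) + (if p = i \<and> i < q then 4 else 0) else 0)"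
    if "p < n" "q < n" for p q
  proof (cases p q rule: linorder_cases)
    case equal
    have "(\<Sum>r<n. (if r = 1 then 2 else 0 :: int)\<^sup>2) = 4"
      using two_le by (subst sum_single[of _ 1]) auto
    with equal show ?thesis by (auto simp: parallel_entry_column column_gram_column)
  next
    case less
    then show ?thesis
    proof (cases "i = j \<and> (i = p \<or> i = q)")
      case True
      with less that show ?thesis unfolding column_gram_def
        by (subst sum_single[of _ "if i = p then q else p"]) (auto simp: parallel_entry_def)
    next
      case False
      with less have "column_gram n (parallel_entry tp p q) i j = 0"
        unfolding column_gram_def by (intro sum.neutral) (auto simp: parallel_entry_def)
      with False less show ?thesis by auto
    qed
  next
    case greater
    then show ?thesis by (auto simp: column_gram_def parallel_entry_def)
  qed
  show ?thesis
  proof (cases "i = j")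
    case True
    have "(\<Sum>p<n. \<Sum>q<n. column_gram n (parallel_entry tp p q) i j) =
        (\<Sum>p<n. \<Sum>q<n. (if q = i \<and> p \<le> i then 4 else 0) + (if p = i \<and> i < q then 4 else 0))"
      using cg True by (intro sum.cong refl) auto
    also have "\<dots> = (\<Sum>p<n. \<Sum>q<n. if q = i \<and> p \<le> i then 4 else 0)
        + (\<Sum>p<n. \<Sum>q<n. if p = i \<and> i < q then 4 else 0)"
      by (simp add: sum.distrib)
    also have "(\<Sum>p<n. \<Sum>q<n. if q = i \<and> p \<le> i then 4 else 0 :: int) = (\<Sum>p<n. if p \<le> i then 4 else 0)"
      using assms by (intro sum.cong refl) (subst sum_single[of _ i], auto)
    also have "(\<Sum>p<n. \<Sum>q<n. if p = i \<and> i < q then 4 else 0 :: int) = (\<Sum>q<n. if i < q then 4 else 0)"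
      using assms by (subst sum_single[of _ i]) auto
    \<comment> \<open>The two conditions are complementary, so together they run through all indices
      below \<open>n\<close> once.\<close>
    also have "(\<Sum>p<n. if p \<le> i then 4 else 0) + (\<Sum>q<n. if i < q then 4 else 0) = (\<Sum>p<n. 4 :: int)"
      unfolding sum.distrib[symmetric] by (intro sum.cong) auto
    finally show ?thesis using True by simp
  qed (simp add: cg)
qed

end

section \<open>The reduction\<close>

definition scaled_mat :: "nat \<Rightarrow> nat \<Rightarrow> (nat \<Rightarrow> nat \<Rightarrow> int) \<Rightarrow> complex mat" where
  "scaled_mat n a e = mat n n (\<lambda>(r, c). complex_of_int (e r c) / complex_of_nat (4 * 2 ^ a))"

text \<open>The repetition over \<open>k\<close> raises the Gram sum of a block from
  \<open>4 * n\<close> to \<open>4 * n ^ 2\<close>. Four blocks then give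
  \<open>(4 * n) ^ 2\<close>, a perfect square, so the scaling factor is rational.\<close>

definition scaled_mats ::
  "nat \<Rightarrow> nat \<Rightarrow> (nat \<Rightarrow> nat \<Rightarrow> nat \<Rightarrow> nat \<Rightarrow> int) \<Rightarrow> complex mat list" where
  "scaled_mats n a e = concat (map (\<lambda>k. concat (map (\<lambda>p. map (\<lambda>q.
     scaled_mat n a (e p q)) [0..<n]) [0..<n])) [0..<n])"

lemma enc_list_map: "enc_list enc (map f xs) = enc_list (enc \<circ> f) xs"
  by (simp add: enc_list_def comp_def)

lemma enc_scaled_mat: "enc_mat (scaled_mat n a e) = matrix_code n a e"
proof -
  have "mat_to_list (scaled_mat n a e) =
      map (\<lambda>r. map (\<lambda>c. complex_of_int (e r c) / complex_of_nat (4 * 2 ^ a)) [0..<n]) [0..<n]"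
    by (simp add: mat_to_list_def scaled_mat_def)
  then show ?thesis
    by (simp add: enc_mat_def matrix_code_def enc_list_map comp_def scaled_code_def)
qed

lemma enc_list_append: "enc_list enc (xs @ ys) = concat (map (\<lambda>x. True # enc x) xs) @ enc_list enc ys"
  by (simp add: enc_list_def)

lemma concat_map_concat: "concat (map f (concat xss)) = concat (map (\<lambda>xs. concat (map f xs)) xss)"
  by (induction xss) auto

lemma sum_list_concat: "sum_list (concat xss) = sum_list (map sum_list xss)"
  for xss :: "'a :: comm_monoid_add list list"
  by (induction xss) auto

lemma enc_scaled_mats:
  "concat (map (\<lambda>V. True # enc_mat V) (scaled_mats n a e)) = matrices_code n a e"
  by (simp add: scaled_mats_def matrices_code_def concat_map_concat comp_def enc_scaled_mat)

lemma length_scaled_mats: "length (scaled_mats n a e) = n ^ 3"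
  by (simp add: scaled_mats_def length_concat comp_def sum_list_triv power3_eq_cube)

lemma set_scaled_mats: "set (scaled_mats n a e) = {scaled_mat n a (e p q) | p q. p < n \<and> q < n}"
proof -
  have "set (scaled_mats n a e) =
      (\<Union>k \<in> {..<n}. \<Union>p \<in> {..<n}. (\<lambda>q. scaled_mat n a (e p q)) ` {..<n})"
    by (simp add: scaled_mats_def atLeast0LessThan)
  then show ?thesis by auto
qed

lemma sum_list_scaled_mats:
  "sum_list (map f (scaled_mats n a e)) =
    of_nat n * (\<Sum>p<n. \<Sum>q<n. f (scaled_mat n a (e p q)))"
  for f :: "complex mat \<Rightarrow> complex"
  by (simp add: scaled_mats_def map_concat comp_def sum_list_concat interv_sum_list_conv_sum_set_nat
      atLeast0LessThan)

lemma scaled_mat_carrier: "scaled_mat n a e \<in> carrier_mat n n"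
  by (simp add: scaled_mat_def)

lemma scaled_mat_rational: "elements_mat (scaled_mat n a e) \<subseteq> gaussian_rationals"
proof -
  have "complex_of_int k / complex_of_nat m \<in> gaussian_rationals" for k m
  proof -
    have "complex_of_int k / complex_of_nat m = complex_of_real (of_int k / of_nat m)" by simp
    moreover have "of_int k / of_nat m \<in> (\<rat> :: real set)" by simp
    ultimately show ?thesis unfolding gaussian_rationals_def by (simp only: Re_complex_of_real Im_complex_of_real mem_Collect_eq Rats_0)
  qed
  then show ?thesis by (auto simp: scaled_mat_def elements_mat_def simp del: of_nat_mult)
qed

section \<open>Gram sum and bilinear forms of the scaled matrices\<close>

lemma adjoint_mult_index:
  assumes "V \<in> carrier_mat n n" "i < n" "j < n"
  shows "(mat_adjoint V * V) $$ (i, j) = (\<Sum>r<n. cnj (V $$ (r, i)) * V $$ (r, j))"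
  using assms by (auto simp: mat_adjoint_def scalar_prod_def atLeast0LessThan)

lemma gram_sum_index:
  assumes "\<And>V. V \<in> set Vs \<Longrightarrow> V \<in> carrier_mat n n"
  shows "gram_sum n Vs \<in> carrier_mat n n"
    and "i < n \<Longrightarrow> j < n \<Longrightarrow> gram_sum n Vs $$ (i, j) =
      sum_list (map (\<lambda>V. \<Sum>r<n. cnj (V $$ (r, i)) * V $$ (r, j)) Vs)"
proof -
  have "gram_sum n Vs \<in> carrier_mat n n \<and> (\<forall>i<n. \<forall>j<n. gram_sum n Vs $$ (i, j) =
      sum_list (map (\<lambda>V. \<Sum>r<n. cnj (V $$ (r, i)) * V $$ (r, j)) Vs))"
    using assms
  proof (induction Vs)
    case Nil
    then show ?case by (simp add: gram_sum_def)
  next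
    case (Cons V Vs)
    have V: "V \<in> carrier_mat n n" using Cons.prems by simp
    have "mat_adjoint V \<in> carrier_mat n n"
      using V by (auto simp: mat_adjoint_def mat_of_rows_def)
    with V have "mat_adjoint V * V \<in> carrier_mat n n" by simp
    moreover have "gram_sum n (V # Vs) = mat_adjoint V * V + gram_sum n Vs"
      by (simp add: gram_sum_def)
    ultimately show ?case using Cons adjoint_mult_index[OF V] by auto
  qed
  then show "gram_sum n Vs \<in> carrier_mat n n"
    and "i < n \<Longrightarrow> j < n \<Longrightarrow> gram_sum n Vs $$ (i, j) =
      sum_list (map (\<lambda>V. \<Sum>r<n. cnj (V $$ (r, i)) * V $$ (r, j)) Vs)"
    by auto
qed

lemma scaled_mat_gram:
  assumes "i < n" "j < n"
  shows "(\<Sum>r<n. cnj (scaled_mat n a e $$ (r, i)) * scaled_mat n a e $$ (r, j)) =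
    of_int (column_gram n e i j) / of_nat (16 * (2 ^ a * 2 ^ a))"
  using assms by (simp add: scaled_mat_def column_gram_def sum_divide_distrib)

lemma scaled_mat_bilinear:
  assumes "x \<in> carrier_vec n" "y \<in> carrier_vec n"
  shows "x \<bullet> (scaled_mat n a e *\<^sub>v y) =
    bilinear n e (\<lambda>i. x $ i) (\<lambda>i. y $ i) / of_nat (4 * 2 ^ a)"
  using assms
  by (auto simp: scaled_mat_def scalar_prod_def bilinear_def sum_divide_distrib sum_distrib_left
      atLeast0LessThan mult_ac intro!: sum.cong)

section \<open>The reduction map and its correctness\<close>

definition reduction :: "clause3 list \<Rightarrow> bilinear_system" where
  "reduction F = (let tp = formula_tape F; a = exponent tp; n = 2 ^ a in
     (n, 4 * n ^ 3,
      scaled_mats n a (conflict_entry tp) @ scaled_mats n a (conflict_entry tp) @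
      scaled_mats n a (parallel_entry tp) @ scaled_mats n a (clause_entry tp)))"

lemma length_formula_tape:
  "length (formula_tape F) = 2 + length (concat (map clause_symbols F)) + length (enc_list enc_clause F)"
  by (simp add: formula_tape_def)

lemma two_le_length_formula_tape: "2 \<le> length (formula_tape F)"
  by (simp add: length_formula_tape)

lemma clause_tape_formula: "clause_tape (formula_tape F) (2 ^ exponent (formula_tape F))"
proof -
  let ?tp = "formula_tape F" and ?A = "concat (map clause_symbols F)"
  let ?n = "2 ^ exponent ?tp :: nat"
  interpret marked_tape ?tp by (rule marked_tape_formula)
  \<comment> \<open>The padding exceeds the clauses by at least one symbol, and rounding half of the
    tape length up leaves room for the clauses and the two leading symbols.\<close>
  have "length ?A + length ?A + 3 \<le> length ?tp"
    using length_concat_clause_symbols[of F] by (simp add: length_formula_tape)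
  then have n: "length ?A + 2 \<le> ?n"
    using exponent_bounds(2)[OF two_le_length_formula_tape] by simp
  have four: "4 \<notin> set ?A" 
  proof -
    have "4 \<notin> set (literal_symbols l)" for l
      using set_digit_symbols[of "snd l"] by (auto simp: literal_symbols_eq sign_symbol_def)
    then have "4 \<notin> set (clause_symbols C)" for C
      by (cases C) (simp del: literal_symbols.simps)
    then show ?thesis by auto
  qed
  show ?thesis
  proof
    fix i
    show "symbol_at ?tp i = 3 \<longleftrightarrow> i = 0" by (rule symbol_at_3_iff)
    show "symbol_at ?tp i = 4 \<longleftrightarrow> i = 1"
    proof (cases i)
      case 0
      then show ?thesis by (simp add: formula_tape_symbols)
    next
      case (Suc k)
      then show ?thesis
        using four symbol_at_in_set[of ?A "k - 1" 4]
        by (cases k) (auto simp: formula_tape_symbols)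
    qed
    assume "symbol_at ?tp i \<in> {5, 6, 7}"
    then have "i < length ?A + 2"
      using formula_tape_symbols[of F] formula_tape_symbols(3)[of F "i - 2"]
      by (cases i; cases "i - 1") (auto split: if_splits)
    with n show "i < ?n" by simp
  next
    show "2 \<le> ?n" using n by simp
  next
    fix p assume "symbol_at ?tp p = 5"
    then show "card (members ?tp p) = 3"
      by (rule formula_tape_clause_position) (simp add: spells_def)
  next
    fix r assume "literal_at ?tp r"
    then show "symbol_at ?tp (clause_start ?tp r) = 5" by (rule formula_tape_literal_start)
  qed
qed

text \<open>Each of the four blocks contributes a quarter of the identity.\<close>

lemma unital_reduction: "unital_system (reduction F)"
proof -
  define tp where "tp = formula_tape F"
  define a where "a = exponent tp"
  define n where "n = (2 :: nat) ^ a"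
  interpret clause_tape tp n unfolding tp_def n_def a_def by (rule clause_tape_formula)
  define Vs where "Vs = scaled_mats n a (conflict_entry tp) @ scaled_mats n a (conflict_entry tp) @
      scaled_mats n a (parallel_entry tp) @ scaled_mats n a (clause_entry tp)"
  have red: "reduction F = (n, 4 * n ^ 3, Vs)"
    by (simp add: reduction_def Let_def tp_def a_def n_def Vs_def)
  have V: "V \<in> carrier_mat n n \<and> elements_mat V \<subseteq> gaussian_rationals" if "V \<in> set Vs" for V
  proof -
    have "\<exists>e. V = scaled_mat n a e" using that unfolding Vs_def set_append set_scaled_mats by blast
    then obtain e where "V = scaled_mat n a e" by blast
    then show ?thesis using scaled_mat_carrier scaled_mat_rational by blast
  qed
  \<comment> \<open>A block repeats its matrices \<open>n\<close> times, so its diagonal entries are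
    \<open>n * (4 * n) / (16 * n ^ 2)\<close>.\<close>
  have part: "sum_list (map (\<lambda>V. \<Sum>r<n. cnj (V $$ (r, i)) * V $$ (r, j)) (scaled_mats n a e)) =
      (if i = j then 1 / 4 else 0)"
    if "i < n" "j < n"
      "(\<Sum>p<n. \<Sum>q<n. column_gram n (e p q) i j) = (if i = j then 4 * int n else 0)" for e i j
  proof -
    have "(\<Sum>p<n. \<Sum>q<n. complex_of_int (column_gram n (e p q) i j)) =
        of_int (\<Sum>p<n. \<Sum>q<n. column_gram n (e p q) i j)" by simp
    also have "\<dots> = (if i = j then 4 * of_nat n else 0)" unfolding that(3) by simp
    finally have "(\<Sum>p<n. \<Sum>q<n. complex_of_int (column_gram n (e p q) i j)) =
        (if i = j then 4 * of_nat n else 0)" .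
    moreover have "n \<noteq> 0" using two_le by simp
    moreover have D: "complex_of_nat (16 * (2 ^ a * 2 ^ a)) = 16 * of_nat n * of_nat n"
      by (simp add: n_def)
    have "sum_list (map (\<lambda>V. \<Sum>r<n. cnj (V $$ (r, i)) * V $$ (r, j)) (scaled_mats n a e)) =
        of_nat n * (\<Sum>p<n. \<Sum>q<n. complex_of_int (column_gram n (e p q) i j)) / (16 * of_nat n * of_nat n)"
      by (simp only: sum_list_scaled_mats scaled_mat_gram[OF that(1,2)] D
          sum_divide_distrib[symmetric] times_divide_eq_right)
    ultimately show ?thesis by (simp only:) simp
  qed
  have "gram_sum n Vs = 1\<^sub>m n"
  proof (rule eq_matI)
    fix i j assume "i < dim_row (1\<^sub>m n :: complex mat)" "j < dim_col (1\<^sub>m n :: complex mat)"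
    then have ij: "i < n" "j < n" by simp_all
    have "gram_sum n Vs $$ (i, j) = sum_list (map (\<lambda>V. \<Sum>r<n. cnj (V $$ (r, i)) * V $$ (r, j)) Vs)"
      using V ij by (intro gram_sum_index) auto
    also have "\<dots> = (if i = j then 1 else 0)"
      using part[OF ij total_gram_conflict[OF ij]] part[OF ij total_gram_parallel[OF ij]]
        part[OF ij total_gram_clause[OF ij]] by (simp add: Vs_def)
    finally show "gram_sum n Vs $$ (i, j) = (1\<^sub>m n :: complex mat) $$ (i, j)" using ij by simp
  qed (use V gram_sum_index(1)[of Vs n] in auto)
  then show ?thesis
    using V two_le by (simp add: red Vs_def length_scaled_mats)
qed

lemma satisfiable_iff_reduction: "satisfiable F \<longleftrightarrow> bilinear_feasible (reduction F)"
proof -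
  define tp where "tp = formula_tape F"
  define a where "a = exponent tp"
  define n where "n = (2 :: nat) ^ a"
  interpret clause_tape tp n unfolding tp_def n_def a_def by (rule clause_tape_formula)
  define Vs where "Vs = scaled_mats n a (conflict_entry tp) @ scaled_mats n a (conflict_entry tp) @
      scaled_mats n a (parallel_entry tp) @ scaled_mats n a (clause_entry tp)"
  let ?E = "{conflict_entry tp, parallel_entry tp, clause_entry tp}"
  have red: "reduction F = (n, 4 * n ^ 3, Vs)" and len: "length Vs = 4 * n ^ 3"
    by (simp_all add: reduction_def Let_def tp_def a_def n_def Vs_def length_scaled_mats)
  have set: "set Vs = {scaled_mat n a (e p q) | e p q. e \<in> ?E \<and> p < n \<and> q < n}"
    unfolding Vs_def set_append set_scaled_mats by blast
  \<comment> \<open>Vanishing at all list positions depends only on the set of matrices, so the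
    repetitions drop out, and the nonzero scaling factor cancels.\<close>
  have zero: "(\<forall>i < 4 * n ^ 3. x \<bullet> (Vs ! i *\<^sub>v y) = 0) \<longleftrightarrow>
      (\<forall>e \<in> ?E. \<forall>p<n. \<forall>q<n. bilinear n (e p q) (\<lambda>i. x $ i) (\<lambda>i. y $ i) = 0)"
    if "x \<in> carrier_vec n" "y \<in> carrier_vec n" for x y
  proof -
    have "(\<forall>i < 4 * n ^ 3. x \<bullet> (Vs ! i *\<^sub>v y) = 0) \<longleftrightarrow> (\<forall>V \<in> set Vs. x \<bullet> (V *\<^sub>v y) = 0)"
      unfolding len[symmetric] by (rule all_set_conv_all_nth[symmetric])
    also have "\<dots> \<longleftrightarrow> (\<forall>e \<in> ?E. \<forall>p<n. \<forall>q<n. x \<bullet> (scaled_mat n a (e p q) *\<^sub>v y) = 0)"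
      unfolding set by blast
    also have "\<dots> \<longleftrightarrow> (\<forall>e \<in> ?E. \<forall>p<n. \<forall>q<n. bilinear n (e p q) (\<lambda>i. x $ i) (\<lambda>i. y $ i) = 0)"
      by (simp add: scaled_mat_bilinear[OF that])
    finally show ?thesis .
  qed
  have nonzero: "x \<noteq> 0\<^sub>v n \<longleftrightarrow> (\<exists>i<n. x $ i \<noteq> 0)" if "x \<in> carrier_vec n" for x :: "complex vec"
    using that by (auto simp: vec_eq_iff)
  have "bilinear_feasible (reduction F) \<longleftrightarrow> (\<exists>x \<in> carrier_vec n. \<exists>y \<in> carrier_vec n.
      (\<exists>i<n. x $ i \<noteq> 0) \<and> (\<exists>i<n. y $ i \<noteq> 0) \<and>
      (\<forall>e \<in> ?E. \<forall>p<n. \<forall>q<n. bilinear n (e p q) (\<lambda>i. x $ i) (\<lambda>i. y $ i) = 0))"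
    unfolding red bilinear_feasible.simps by (intro bex_cong refl) (simp only: zero nonzero)
  also have "\<dots> \<longleftrightarrow> feasible"
  proof
    assume feasible
    then obtain x y where xy: "\<exists>i<n. x i \<noteq> 0" "\<exists>i<n. y i \<noteq> 0"
      "\<forall>e \<in> ?E. \<forall>p<n. \<forall>q<n. bilinear n (e p q) x y = 0"
      unfolding feasible_def by blast
    \<comment> \<open>The form reads only indices below \<open>n\<close>, so functions may be cut
      off to vectors.\<close>
    have cong: "bilinear n e (\<lambda>i. vec n x $ i) (\<lambda>i. vec n y $ i) = bilinear n e x y" for e
      unfolding bilinear_def by (intro sum.cong) auto
    have "vec n x \<in> carrier_vec n" "vec n y \<in> carrier_vec n"
      "\<exists>i<n. vec n x $ i \<noteq> 0" "\<exists>i<n. vec n y $ i \<noteq> 0" using xy by auto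
    with xy(3) show "\<exists>x \<in> carrier_vec n. \<exists>y \<in> carrier_vec n.
      (\<exists>i<n. x $ i \<noteq> 0) \<and> (\<exists>i<n. y $ i \<noteq> 0) \<and>
      (\<forall>e \<in> ?E. \<forall>p<n. \<forall>q<n. bilinear n (e p q) (\<lambda>i. x $ i) (\<lambda>i. y $ i) = 0)"
      by (intro bexI[of _ "vec n x"] bexI[of _ "vec n y"]) (simp_all add: cong)
  qed (unfold feasible_def, blast)
  also have "\<dots> \<longleftrightarrow> (\<exists>X. selection tp X)"
    using feasible_imp_selection selection_imp_feasible by blast
  also have "\<dots> \<longleftrightarrow> satisfiable F"
    unfolding tp_def by (rule satisfiable_iff_selection[symmetric])
  finally show ?thesis ..
qed

lemma reduction_computable:
  "poly_time_computable_on UNIV (enc_list enc_clause) enc_bilinear_system reduction"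
proof (rule program_computes[OF wf_reduction_prog])
  fix F
  interpret marked_tape "formula_tape F" by (rule marked_tape_formula)
  show "snd (run (formula_tape F) reduction_prog (\<lambda>_. length (formula_tape F), [])) =
      enc_bilinear_system (reduction F)"
    unfolding run_reduction_prog[OF two_le_length_formula_tape]
    by (simp add: reduction_def Let_def enc_list_append enc_scaled_mats)
      (simp add: enc_list_def enc_scaled_mats)
qed

theorem theorem2:
  shows "poly_time_reducible three_sat unital_bilinear_feasibility"
  unfolding poly_time_reducible_def
proof (intro exI[of _ reduction] conjI ballI)
  show "reduction \<in> instances three_sat \<rightarrow> instances unital_bilinear_feasibility"
    by (simp add: unital_bilinear_feasibility_def unital_reduction)
next
  fix F
  show "question three_sat F \<longleftrightarrow> question unital_bilinear_feasibility (reduction F)"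
    by (simp add: three_sat_def unital_bilinear_feasibility_def satisfiable_iff_reduction)
next
  show "poly_time_computable_on (instances three_sat) (encoding three_sat)
      (encoding unital_bilinear_feasibility) reduction"
    using reduction_computable by (simp add: three_sat_def unital_bilinear_feasibility_def)
qed

end
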